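(* Let $p \in (0,1)$ be fixed. There exists a constant $c = c(p) > 0$ such that $$\limsup_{n\to\infty} \mathbb{P}\left[ r_{+}(G(n,p)) \geq c \right] \geq c.$$
   Context: $G(n,p)$ is the Erdős–Rényi random graph on $n$ vertices in which each pair of vertices is joined by an edge independently with probability $p$. For a finite simple graph $G=(V,E)$ with $n$ vertices, adjacency matrix $A$ and diagonal degree matrix $D$, the normalized Laplacian is $\mathcal{L}_G = D^{-1/2}(D-A)D^{-1/2}$, where, by convention, the diagonal entry of $D^{-1/2}$ at a vertex of degree $0$ is $0$. Its eigenvalues are listed in increasing order $0=\lambda_1(\mathcal{L}_G) \le \lambda_2(\mathcal{L}_G) \le \dots \le \lambda_n(\mathcal{L}_G)$, and $\lambda_2(\mathcal{L}_G)$ is called the spectral gap of $G$. The quantity $r_{-}(G)$ is the fraction of edges $e\in E$ such that removing $e$ from $G$ decreases the spectral gap, i.e. $\lambda_2(\mathcal{L}_{G - e}) < \lambda_2(\mathcal{L}_G)$ with $G-e = (V, E\setminus\{e\})$, and $r_{+}(G) := 1 - r_{-}(G)$. *)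

theory Defs
  imports "Jordan_Normal_Form.Char_Poly" "HOL-Probability.Product_PMF"
begin

text \<open>A finite simple graph on the vertex set \<open>{..<n}\<close> is given by its edge set, a subset of
  \<open>vertex_pairs n\<close>.\<close>

definition vertex_pairs :: "nat \<Rightarrow> nat set set" where
  "vertex_pairs n = {e. e \<subseteq> {..<n} \<and> card e = 2}"

definition degree_of :: "nat set set \<Rightarrow> nat \<Rightarrow> nat" where
  "degree_of E v = card {e \<in> E. v \<in> e}"

definition adjacency_matrix :: "nat \<Rightarrow> nat set set \<Rightarrow> real mat" where
  "adjacency_matrix n E = Matrix.mat n n (\<lambda>(i, j). if i \<noteq> j \<and> {i, j} \<in> E then 1 else 0)"

definition degree_matrix :: "nat \<Rightarrow> nat set set \<Rightarrow> real mat" where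
  "degree_matrix n E = mat_diag n (\<lambda>i. real (degree_of E i))"

definition degree_matrix_inv_sqrt :: "nat \<Rightarrow> nat set set \<Rightarrow> real mat" where
  "degree_matrix_inv_sqrt n E =
     mat_diag n (\<lambda>i. if degree_of E i = 0 then 0 else 1 / sqrt (real (degree_of E i)))"

definition normalized_laplacian :: "nat \<Rightarrow> nat set set \<Rightarrow> real mat" where
  "normalized_laplacian n E =
     degree_matrix_inv_sqrt n E * (degree_matrix n E - adjacency_matrix n E)
       * degree_matrix_inv_sqrt n E"

text \<open>The real eigenvalues of a matrix in increasing order, repeated according to algebraic
  multiplicity; for a symmetric matrix these are all its eigenvalues.\<close>

definition sorted_eigenvalues :: "real mat \<Rightarrow> real list" where
  "sorted_eigenvalues M = sorted_list_of_multiset (proots (char_poly M))"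

text \<open>List positions start at 0, so position 1 holds the second smallest eigenvalue.
  For \<open>n \<le> 1\<close> the value is unspecified; such graphs have no edges.\<close>

definition spectral_gap :: "nat \<Rightarrow> nat set set \<Rightarrow> real" where
  "spectral_gap n E = sorted_eigenvalues (normalized_laplacian n E) ! 1"

text \<open>For \<open>E = {}\<close> division by zero gives \<open>r_minus n E = 0\<close>.\<close>

definition r_minus :: "nat \<Rightarrow> nat set set \<Rightarrow> real" where
  "r_minus n E = real (card {e \<in> E. spectral_gap n (E - {e}) < spectral_gap n E}) / real (card E)"

definition r_plus :: "nat \<Rightarrow> nat set set \<Rightarrow> real" where
  "r_plus n E = 1 - r_minus n E"

definition gnp :: "nat \<Rightarrow> real \<Rightarrow> nat set set pmf" where
  "gnp n p = map_pmf (\<lambda>f. {e. f e}) (Pi_pmf (vertex_pairs n) False (\<lambda>_. bernoulli_pmf p))"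

end

theory Submission
  imports Defs "HOL-Probability.Hoeffding" "HOL-Real_Asymp.Real_Asymp"
begin

text \<open>Under the product measure, deleting a present edge and inserting an absent one are exchanged
  up to the factor \<open>p / (1 - p)\<close>. So it suffices that with probability at least \<open>1/2\<close> there are
  quadratically many non-edges \<open>uv\<close> whose insertion does not increase the spectral gap.

  Let \<open>x\<close> attain the gap \<open>1 - \<mu>\<close> in the variational characterisation. Testing the enlarged graph with
  \<open>x\<close> shows that the gap does not increase if
  \<open>(\<mu> + 2 / \<Sum>deg) (x\<^sub>u\<^sup>2 + x\<^sub>v\<^sup>2) \<le> 2 x\<^sub>u x\<^sub>v\<close>. As \<open>\<mu> = O(n\<^bsup>-1/2\<^esup>)\<close>, it is enough that linearly many
  coordinates of \<open>x\<close> have the same sign and comparable size.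

  Let \<open>M\<close> be the adjacency matrix with its off-diagonal mean \<open>p\<close> subtracted. A union bound over a
  net together with Hoeffding's inequality gives \<open>\<bar>y\<^sup>T M y\<bar> \<le> 15 \<surd>n \<bar>y\<bar>\<^sup>2\<close> for all \<open>y\<close>, and \<open>\<le> \<epsilon> \<surd>n \<bar>y\<bar>\<^sup>2\<close>
  for all \<open>y\<close> with at most \<open>c n\<close> nonzero coordinates. The vector \<open>e\<^sub>u + s M e\<^sub>u\<close> witnesses that
  \<open>\<mu>\<close> is at least of order \<open>n\<^bsup>-1/2\<^esup>\<close>, so \<open>x\<^sup>T M x\<close> is at least of order \<open>\<surd>n\<close>. By the sparse bound, \<open>x\<close>
  cannot be concentrated on fewer than \<open>c n\<close> coordinates.\<close>

section \<open>The second eigenvalue of a positive semidefinite matrix\<close>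

text \<open>Insertions are studied because a test vector bounds the gap of the altered graph only
  from above. With \<open>F = E - {e}\<close>, the edge \<open>e\<close> counts towards
  \<open>r_plus\<close> of \<open>E\<close> exactly when the gap of \<open>insert e F\<close> is at
  most that of \<open>F\<close>, and the minimizer for \<open>F\<close> can test this. The minimizer
  depends on the graph, so no tail estimate applies to it directly. Both bounds on \<open>M\<close>
  are therefore uniform over all vectors; apart from them, only the degrees are controlled
  probabilistically. The order of the constants matters. The lower bound on the noise form of the
  minimizer fixes \<open>kappa\<close>, and \<open>kappa\<close> fixes \<open>eps\<close>. Only then
  is the sparsity level \<open>c\<close> chosen, so small that the exponentially many net points
  with at most \<open>c * n\<close> nonzero coordinates are still outweighed by the Hoeffding
  exponent, a fixed multiple of \<open>eps^2 * n\<close>. A separate obstacle is that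
  \<open>spectral_gap\<close> is an entry in a sorted list of roots. Its variational form is
  obtained by splitting one root 0 off the characteristic polynomial and minimizing on the
  orthogonal complement of the kernel vector, with no diagonalization.\<close>

definition dot :: "nat \<Rightarrow> (nat \<Rightarrow> real) \<Rightarrow> (nat \<Rightarrow> real) \<Rightarrow> real" where
  "dot n x y = (\<Sum>i<n. x i * y i)"

definition mv :: "nat \<Rightarrow> (nat \<Rightarrow> nat \<Rightarrow> real) \<Rightarrow> (nat \<Rightarrow> real) \<Rightarrow> nat \<Rightarrow> real" where
  "mv n B x i = (\<Sum>j<n. B i j * x j)"

definition bform :: "nat \<Rightarrow> (nat \<Rightarrow> nat \<Rightarrow> real) \<Rightarrow> (nat \<Rightarrow> real) \<Rightarrow> (nat \<Rightarrow> real) \<Rightarrow> real" where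
  "bform n B x y = dot n x (mv n B y)"

lemma bform_alt: "bform n B x y = (\<Sum>i<n. \<Sum>j<n. B i j * x i * y j)"
  by (simp add: bform_def dot_def mv_def sum_distrib_left mult_ac)

lemma dot_commute: "dot n x y = dot n y x"
  by (simp add: dot_def mult.commute)

lemma dot_add_left: "dot n (\<lambda>i. x i + y i) z = dot n x z + dot n y z"
  and dot_add_right: "dot n z (\<lambda>i. x i + y i) = dot n z x + dot n z y"
  and dot_diff_left: "dot n (\<lambda>i. x i - y i) z = dot n x z - dot n y z"
  and dot_diff_right: "dot n z (\<lambda>i. x i - y i) = dot n z x - dot n z y"
  and dot_scale_left: "dot n (\<lambda>i. c * x i) z = c * dot n x z"
  and dot_scale_right: "dot n z (\<lambda>i. c * x i) = c * dot n z x"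
  by (simp_all add: dot_def algebra_simps sum.distrib sum_subtractf sum_distrib_left)

lemma mv_add: "mv n B (\<lambda>i. x i + y i) = (\<lambda>i. mv n B x i + mv n B y i)"
  and mv_diff: "mv n B (\<lambda>i. x i - y i) = (\<lambda>i. mv n B x i - mv n B y i)"
  and mv_scale: "mv n B (\<lambda>i. c * x i) = (\<lambda>i. c * mv n B x i)"
  by (simp_all add: mv_def fun_eq_iff algebra_simps sum.distrib sum_subtractf sum_distrib_left)

lemmas dot_linear = dot_add_left dot_add_right dot_diff_left dot_diff_right
  dot_scale_left dot_scale_right mv_add mv_diff mv_scale

lemma dot_cong: "(\<And>i. i < n \<Longrightarrow> x i = x' i) \<Longrightarrow> (\<And>i. i < n \<Longrightarrow> y i = y' i) \<Longrightarrow> dot n x y = dot n x' y'"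
  by (simp add: dot_def)

lemma dot_nonneg: "0 \<le> dot n x x"
  by (simp add: dot_def sum_nonneg)

lemma dot_eq_0_iff: "dot n x x = 0 \<longleftrightarrow> (\<forall>i<n. x i = 0)"
  unfolding dot_def by (subst sum_nonneg_eq_0_iff) auto

lemma bform_commute:
  assumes "\<And>i j. i < n \<Longrightarrow> j < n \<Longrightarrow> B i j = B j i"
  shows "bform n B x y = bform n B y x"
  unfolding bform_alt by (subst sum.swap) (intro sum.cong refl, simp add: assms mult_ac)

text \<open>Existence by compactness. Vectors are functions on all of \<open>nat\<close>, so the
  unit sphere is cut out of a product of intervals whose coordinates from \<open>n\<close> on are
  pinned to 0; this product is compact by Tychonoff. The vector \<open>y0\<close> makes the
  constraint set nonempty.\<close>

lemma Rayleigh_minimum: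
  assumes "dot n y0 w = 0" "dot n y0 y0 \<noteq> 0"
  obtains y where "dot n y w = 0" "dot n y y = 1"
    "\<And>z. dot n z w = 0 \<Longrightarrow> bform n B y y * dot n z z \<le> bform n B z z"
proof -
  define R where "R = PiE UNIV (\<lambda>i. if i < n then {-1..1::real} else {0})"
  define K where "K = R \<inter> {x. dot n x w = 0} \<inter> {x. dot n x x = 1}"
  have "compactin (product_topology (\<lambda>i. euclidean) UNIV) R"
    unfolding R_def by (subst compactin_PiE) auto
  then have "compact R" by (simp add: euclidean_product_topology)
  have cont: "continuous_on S (\<lambda>x. dot n x w)" "continuous_on S (\<lambda>x. dot n x x)"
    "continuous_on S (\<lambda>x. bform n B x x)" for S
    unfolding bform_def dot_def mv_def
    by (intro continuous_intros continuous_on_product_then_coordinatewise[OF continuous_on_id])+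
  have "closed {x. dot n x w = 0}" "closed {x. dot n x x = 1}"
    by (auto intro!: closed_Collect_eq cont continuous_intros)
  then have "compact K"
    unfolding K_def using \<open>compact R\<close> by (intro compact_Int_closed) auto
  have norm: "\<exists>x\<in>K. \<forall>i<n. x i = z i / sqrt (dot n z z)"
    if z: "dot n z w = 0" "dot n z z \<noteq> 0" for z
  proof -
    have pos: "dot n z z > 0" using z dot_nonneg[of n z] by linarith
    define x where "x i = (if i < n then inverse (sqrt (dot n z z)) * z i else 0)" for i
    have "dot n x w = dot n (\<lambda>i. inverse (sqrt (dot n z z)) * z i) w"
      by (intro dot_cong) (simp_all add: x_def)
    then have 1: "dot n x w = 0" using z by (simp add: dot_scale_left)
    have "dot n x x = dot n (\<lambda>i. inverse (sqrt (dot n z z)) * z i) (\<lambda>i. inverse (sqrt (dot n z z)) * z i)"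
      by (intro dot_cong) (simp_all add: x_def)
    then have 2: "dot n x x = 1" using pos
      by (simp add: dot_scale_left dot_scale_right flip: power2_eq_square mult.assoc)
        (simp add: field_simps flip: real_sqrt_inverse)
    have "\<bar>x i\<bar> \<le> 1" if "i < n" for i
    proof -
      have "x i * x i \<le> dot n x x" unfolding dot_def
        using that by (intro member_le_sum) auto
      then have "(x i)\<^sup>2 \<le> 1" using 2 by (simp add: power2_eq_square)
      then show ?thesis by (simp add: abs_square_le_1)
    qed
    then have "x \<in> K" using 1 2 by (auto simp: K_def R_def x_def abs_le_iff)
    then show ?thesis by (auto simp: x_def field_simps intro!: bexI[of _ x])
  qed
  have "K \<noteq> {}" using norm[OF assms] by auto
  from continuous_attains_inf[OF \<open>compact K\<close> this cont(3)]
  obtain y where y: "y \<in> K" "\<And>z. z \<in> K \<Longrightarrow> bform n B y y \<le> bform n B z z" by auto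
  show ?thesis
  proof
    show "dot n y w = 0" "dot n y y = 1" using y by (auto simp: K_def)
    fix z assume z: "dot n z w = 0"
    show "bform n B y y * dot n z z \<le> bform n B z z"
    proof (cases "dot n z z = 0")
      case True
      then have "bform n B z z = 0" by (simp add: dot_eq_0_iff bform_alt)
      with True show ?thesis by simp
    next
      case False
      then obtain x where x: "x \<in> K" "\<And>i. i < n \<Longrightarrow> x i = z i / sqrt (dot n z z)"
        using norm z by metis
      have "bform n B x x = bform n B z z / dot n z z"
        unfolding bform_alt sum_divide_distrib
        using dot_nonneg[of n z] by (intro sum.cong refl) (simp add: x)
      then have "bform n B z z = bform n B x x * dot n z z" using False by simp
      then show ?thesis using y(2)[OF x(1)] dot_nonneg[of n z] by (simp add: mult_right_mono)
    qed
  qed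
qed

text \<open>Near 0 the linear term dominates, so a nonzero \<open>c\<close> would produce a negative
  value for one sign of \<open>t\<close>; the witness is scaled by \<open>\<bar>d\<bar> + 1\<close>
  to keep the quadratic term below half of the linear one.\<close>

lemma quadratic_nonneg_linear_coeff:
  fixes c d :: real
  assumes "\<And>t. 0 \<le> 2 * t * c + t\<^sup>2 * d"
  shows "c = 0"
proof (rule ccontr)
  assume "c \<noteq> 0"
  define t where "t = - c / (\<bar>d\<bar> + 1)"
  have "t\<^sup>2 * d \<le> t\<^sup>2 * (\<bar>d\<bar> + 1)" by (intro mult_left_mono) auto
  also have "\<dots> = - t * c" by (simp add: t_def power2_eq_square)
  finally have "0 \<le> t * c" using assms[of t] by linarith
  moreover have "t * c = - (c\<^sup>2 / (\<bar>d\<bar> + 1))" by (simp add: t_def power2_eq_square)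
  moreover have "0 < c\<^sup>2 / (\<bar>d\<bar> + 1)" using \<open>c \<noteq> 0\<close> by (intro divide_pos_pos) auto
  ultimately show False by simp
qed

text \<open>First variation: the residual \<open>r\<close> is orthogonal to every direction
  orthogonal to \<open>w\<close>. It is such a direction itself, because \<open>B\<close> is
  symmetric and annihilates \<open>w\<close>, so it is orthogonal to itself and vanishes.\<close>

lemma Rayleigh_minimizer_eigenvector:
  assumes sym: "\<And>i j. i < n \<Longrightarrow> j < n \<Longrightarrow> B i j = B j i"
    and w: "\<And>i. i < n \<Longrightarrow> mv n B w i = 0"
    and y: "dot n y w = 0" "dot n y y = 1"
      "\<And>z. dot n z w = 0 \<Longrightarrow> bform n B y y * dot n z z \<le> bform n B z z"
    and "i < n"
  shows "mv n B y i = bform n B y y * y i"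
proof -
  define m where "m = bform n B y y"
  define r where "r i = mv n B y i - m * y i" for i
  have var: "dot n z r = 0" if z: "dot n z w = 0" for z
  proof (rule quadratic_nonneg_linear_coeff)
    fix t
    have "dot n (\<lambda>i. y i + t * z i) w = 0" using y z by (simp add: dot_linear)
    from y(3)[OF this]
    have "m * (1 + 2 * t * dot n y z + t\<^sup>2 * dot n z z) \<le>
        m + t * bform n B y z + t * bform n B z y + t\<^sup>2 * bform n B z z"
      using y dot_commute[of n z y]
      by (simp add: bform_def dot_linear algebra_simps power2_eq_square m_def)
    moreover have "bform n B y z = bform n B z y" by (rule bform_commute) (rule sym)
    moreover have zr: "dot n z r = bform n B z y - m * dot n y z"
      by (simp add: r_def[abs_def] dot_linear bform_def dot_commute[of n y z])
    ultimately show "0 \<le> 2 * t * dot n z r + t\<^sup>2 * (bform n B z z - m * dot n z z)"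
      unfolding zr by (simp add: algebra_simps)
  qed
  have "dot n w (mv n B y) = bform n B y w"
    unfolding bform_def[symmetric] by (rule bform_commute) (rule sym)
  also have "\<dots> = 0" unfolding bform_def dot_def by (simp add: w)
  finally have "dot n r w = 0" using y
    by (simp add: r_def[abs_def] dot_linear dot_commute[of n w])
  then have "dot n r r = 0" by (rule var)
  then show ?thesis using \<open>i < n\<close> by (simp add: dot_eq_0_iff r_def m_def)
qed

section \<open>Deflation by a kernel vector\<close>

lemma eigenvalue_mat_iff:
  "eigenvalue (Matrix.mat n n (\<lambda>(i, j). B i j)) k \<longleftrightarrow>
     (\<exists>y. (\<exists>i<n. y i \<noteq> 0) \<and> (\<forall>i<n. mv n B y i = k * y i))" (is "?L \<longleftrightarrow> ?R")
proof
  assume ?L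
  then obtain v where v: "v \<in> carrier_vec n" "v \<noteq> 0\<^sub>v n"
    and e: "Matrix.mat n n (\<lambda>(i, j). B i j) *\<^sub>v v = k \<cdot>\<^sub>v v"
    by (auto simp: eigenvalue_def eigenvector_def)
  have "mv n B (vec_index v) i = k * vec_index v i" if "i < n" for i
    using arg_cong[OF e, of "\<lambda>u. vec_index u i"] that v
    by (simp add: mv_def scalar_prod_def lessThan_atLeast0)
  moreover have "\<exists>i<n. vec_index v i \<noteq> 0"
  proof (rule ccontr)
    assume "\<not> ?thesis"
    then have "v = 0\<^sub>v n" using v(1) by (intro eq_vecI) auto
    with v show False by simp
  qed
  ultimately show ?R by blast
next
  assume ?R
  then obtain y where y: "\<exists>i<n. y i \<noteq> 0" "\<And>i. i < n \<Longrightarrow> mv n B y i = k * y i" by blast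
  define v where "v = Matrix.vec n y"
  have "v \<noteq> 0\<^sub>v n"
  proof
    assume "v = 0\<^sub>v n"
    then have "\<forall>i<n. vec_index v i = 0" by simp
    then show False using y(1) by (auto simp: v_def)
  qed
  moreover have "Matrix.mat n n (\<lambda>(i, j). B i j) *\<^sub>v v = k \<cdot>\<^sub>v v"
    by (rule eq_vecI) (use y(2) in \<open>auto simp: v_def mv_def scalar_prod_def lessThan_atLeast0\<close>)
  ultimately show ?L unfolding eigenvalue_def eigenvector_def
    by (intro exI[of _ v]) (auto simp: v_def)
qed

text \<open>Conjugation by the matrix with columns \<open>w, e\<^sub>1, \<dots>, e\<^sub>n\<close>. The reduced matrix is not symmetric;
  it represents \<open>B\<close> on the quotient by \<open>w\<close>, which is isomorphic to the orthogonal complement of \<open>w\<close>.\<close>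
lemma char_poly_deflate:
  assumes w: "\<And>i. i \<le> n \<Longrightarrow> mv (Suc n) B w i = 0" and w0: "w 0 \<noteq> 0"
  shows "char_poly (Matrix.mat (Suc n) (Suc n) (\<lambda>(i, j). B i j)) = [:0, 1:] *
     char_poly (Matrix.mat n n (\<lambda>(i, j). B (Suc i) (Suc j) - w (Suc i) / w 0 * B 0 (Suc j)))"
proof -
  let ?n = "Suc n"
  define A where "A = Matrix.mat ?n ?n (\<lambda>(i, j). B i j)"
  define p where "p i j = (if j = 0 then w i else if i = j then 1 else 0)" for i j
  \<comment> \<open>\<open>Q\<close> is the inverse of \<open>P\<close>, available because
    \<open>w 0\<close> is nonzero. As a sum of two conditionals, its entries make each row sum split
    into two single-term sums.\<close>
  define q where "q i j = (if j = 0 then (if i = 0 then 1 / w 0 else - w i / w 0) else 0) +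
    (if j = i then (if i = 0 then 0 else 1) else 0)" for i j
  define P where "P = Matrix.mat ?n ?n (\<lambda>(i, j). p i j)"
  define Q where "Q = Matrix.mat ?n ?n (\<lambda>(i, j). q i j)"
  define C where "C = Q * (A * P)"
  have carr: "A \<in> carrier_mat ?n ?n" "P \<in> carrier_mat ?n ?n" "Q \<in> carrier_mat ?n ?n"
    by (simp_all add: A_def P_def Q_def)
  then have C: "C \<in> carrier_mat ?n ?n" by (simp add: C_def)
  have q_sum: "(\<Sum>k\<in>{0..<?n}. q i k * f k) = (if i = 0 then f 0 / w 0 else f i - w i / w 0 * f 0)"
    if "i < ?n" for i f
    using that unfolding q_def distrib_right sum.distrib
    by (simp add: if_distrib[of "\<lambda>x. x * _"] sum.delta cong: if_cong del: sum.op_ivl_Suc)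
  have p_sum: "(\<Sum>k\<in>{0..<?n}. f k * p k j) = (if j = 0 then \<Sum>k<?n. f k * w k else f j)"
    if "j < ?n" for j f
    using that unfolding p_def
    by (simp add: if_distrib[of "\<lambda>x. _ * x"] sum.delta lessThan_atLeast0 cong: if_cong del: sum.op_ivl_Suc)
  have QP: "Q * P = 1\<^sub>m ?n"
    by (rule eq_matI) (use w0 carr in \<open>auto simp: P_def Q_def scalar_prod_def q_sum p_def
      simp del: sum.op_ivl_Suc\<close>)
  have PQ: "P * Q = 1\<^sub>m ?n" using mat_mult_left_right_inverse[OF carr(3,2) QP] .
  have "P * C = (P * Q) * (A * P)"
    unfolding C_def using carr by (intro assoc_mult_mat[symmetric, of _ ?n ?n _ ?n _ ?n]) auto
  then have "P * C * Q = A * P * Q" using carr PQ by simp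
  also have "\<dots> = A * (P * Q)" using carr by (intro assoc_mult_mat[of _ ?n ?n _ ?n _ ?n]) auto
  finally have "A = P * C * Q" using carr PQ by simp
  then have "similar_mat A C"
    unfolding similar_mat_def similar_mat_wit_def using carr C PQ QP
    by (intro exI[of _ P] exI[of _ Q]) (auto simp: Let_def)
  then have cp: "char_poly A = char_poly C" by (rule char_poly_similar)
  \<comment> \<open>The first column of \<open>A * P\<close> is \<open>B w = 0\<close>. It stays
    zero after multiplication by \<open>Q\<close>, which lets the linear factor split off.\<close>
  have APc: "A * P = Matrix.mat ?n ?n (\<lambda>(i, j). if j = 0 then 0 else B i j)"
  proof (rule eq_matI)
    fix i j assume "i < dim_row (Matrix.mat ?n ?n (\<lambda>(i, j). if j = 0 then 0 else B i j))"
      "j < dim_col (Matrix.mat ?n ?n (\<lambda>(i, j). if j = 0 then 0 else B i j))"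
    then have ij: "i < ?n" "j < ?n" by auto
    then have "(A * P) $$ (i, j) = (\<Sum>k\<in>{0..<?n}. B i k * p k j)"
      by (simp add: A_def P_def scalar_prod_def del: sum.op_ivl_Suc)
    then show "(A * P) $$ (i, j) = Matrix.mat ?n ?n (\<lambda>(i, j). if j = 0 then 0 else B i j) $$ (i, j)"
      using ij w[of i] by (simp add: p_sum mv_def del: sum.op_ivl_Suc sum.lessThan_Suc)
  qed (use carr in auto)
  have Cij: "C $$ (i, j) = (if j = 0 then 0 else if i = 0 then B 0 j / w 0 else B i j - w i / w 0 * B 0 j)"
    if "i < ?n" "j < ?n" for i j
  proof -
    have "C $$ (i, j) = (\<Sum>k\<in>{0..<?n}. q i k * (if j = 0 then 0 else B k j))"
      using that by (simp add: C_def APc Q_def scalar_prod_def del: sum.op_ivl_Suc)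
    then show ?thesis using that by (simp add: q_sum del: sum.op_ivl_Suc)
  qed
  have "char_poly C = monom 1 1 * char_poly (mat_delete C 0 0)"
    by (rule char_poly_0_column[of ?n]) (use C Cij in auto)
  also have "monom 1 1 = [:0, 1::real:]" by (rule x_as_monom[symmetric])
  also have "mat_delete C 0 0 = Matrix.mat n n (\<lambda>(i, j). B (Suc i) (Suc j) - w (Suc i) / w 0 * B 0 (Suc j))"
    by (rule eq_matI) (use C in \<open>auto simp: mat_delete_def Cij\<close>)
  finally show ?thesis using cp by (simp add: A_def)
qed

text \<open>Removing one copy of the bottom value and taking the minimum of the rest respects
  multiplicity: if \<open>a\<close> occurs again in \<open>M\<close>, then
  \<open>m = a\<close>.\<close>

lemma sorted_list_of_multiset_nth_1:
  assumes "\<And>x. x \<in># M \<Longrightarrow> a \<le> x" "m \<in># M" "\<And>x. x \<in># M \<Longrightarrow> m \<le> x"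
  shows "sorted_list_of_multiset (add_mset a M) ! 1 = m"
proof -
  obtain N where N: "M = add_mset m N" using assms(2) by (metis mset_add)
  have "insort m (sorted_list_of_multiset N) = m # sorted_list_of_multiset N"
    using assms(3) by (intro insort_is_Cons) (auto simp: N)
  moreover have "insort a (m # sorted_list_of_multiset N) = a # m # sorted_list_of_multiset N"
    using assms(1) by (intro insort_is_Cons) (auto simp: N)
  ultimately show ?thesis by (simp add: N)
qed

text \<open>By deflation the roots are one 0 and the eigenvalues of \<open>D\<close>, so the task is
  to identify the least of the latter with the constrained minimum. Eigenvectors of \<open>D\<close>
  lift to vectors orthogonal to \<open>w\<close> with that Rayleigh quotient, and conversely the
  minimizer descends to an eigenvector of \<open>D\<close>.\<close>

lemma second_eigenvalue_Rayleigh: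
  assumes sym: "\<And>i j. i < n \<Longrightarrow> j < n \<Longrightarrow> B i j = B j i"
    and w: "\<And>i. i < n \<Longrightarrow> mv n B w i = 0" and w0: "w 0 \<noteq> 0"
    and psd: "\<And>x. 0 \<le> bform n B x x" and "2 \<le> n"
  defines "m \<equiv> sorted_eigenvalues (Matrix.mat n n (\<lambda>(i, j). B i j)) ! 1"
  obtains y where "dot n y w = 0" "dot n y y = 1" "bform n B y y = m"
    "\<And>z. dot n z w = 0 \<Longrightarrow> m * dot n z z \<le> bform n B z z"
proof -
  obtain k where n: "n = Suc k" and "k \<ge> 1" using \<open>2 \<le> n\<close> by (cases n) auto
  \<comment> \<open>A nonzero vector orthogonal to \<open>w\<close>; this is where two coordinates
    are required.\<close>
  define y0 where "y0 i = (if i = 0 then - w 1 else if i = 1 then w 0 else 0)" for i :: nat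
  have "dot n y0 w = (\<Sum>i\<in>{0,1}. y0 i * w i)"
    unfolding dot_def using \<open>2 \<le> n\<close> by (intro sum.mono_neutral_right) (auto simp: y0_def)
  then have "dot n y0 w = 0" by (simp add: y0_def)
  moreover have "dot n y0 y0 \<noteq> 0" using \<open>2 \<le> n\<close> w0 
    by (auto simp: dot_eq_0_iff y0_def intro!: exI[of _ 1])
  ultimately obtain y where y: "dot n y w = 0" "dot n y y = 1"
    and min: "\<And>z. dot n z w = 0 \<Longrightarrow> bform n B y y * dot n z z \<le> bform n B z z"
    by (rule Rayleigh_minimum) blast
  have ev: "mv n B y i = bform n B y y * y i" if "i < n" for i
    by (rule Rayleigh_minimizer_eigenvector[OF sym w y min that])
  define D where "D i j = B (Suc i) (Suc j) - w (Suc i) / w 0 * B 0 (Suc j)" for i j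
  let ?D = "Matrix.mat k k (\<lambda>(i, j). D i j)"
  have cp: "char_poly (Matrix.mat n n (\<lambda>(i, j). B i j)) = [:0, 1:] * char_poly ?D"
    unfolding n D_def by (rule char_poly_deflate) (use w w0 n in auto)
  have Dc: "?D \<in> carrier_mat k k" by simp
  then have "char_poly ?D \<noteq> 0" using degree_monic_char_poly[OF Dc] by auto
  then have "proots (char_poly (Matrix.mat n n (\<lambda>(i, j). B i j))) = add_mset 0 (proots (char_poly ?D))"
    unfolding cp by (subst proots_mult) (auto simp: proots_linear_factor)
  moreover have root: "x \<in># proots (char_poly ?D) \<longleftrightarrow> eigenvalue ?D x" for x
    using \<open>char_poly ?D \<noteq> 0\<close> by (simp add: eigenvalue_root_char_poly[OF Dc])
  \<comment> \<open>A class modulo \<open>w\<close> has a unique representative vanishing at 0.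
    \<open>D\<close> applies \<open>B\<close> to it and reduces the result modulo \<open>w\<close>
    to such a representative.\<close>
  have shift: "mv k D (\<lambda>i. z (Suc i)) i = mv n B z (Suc i) - w (Suc i) / w 0 * mv n B z 0"
    if "z 0 = 0" for z i
    using that by (simp add: mv_def D_def n sum.lessThan_Suc_shift algebra_simps sum_subtractf
      sum_distrib_left sum_divide_distrib del: sum.lessThan_Suc)
  have le: "bform n B y y \<le> x" if "eigenvalue ?D x" for x
  proof -
    from that obtain v where v: "\<exists>i<k. v i \<noteq> 0" "\<And>i. i < k \<Longrightarrow> mv k D v i = x * v i"
      unfolding eigenvalue_mat_iff by blast
    define z where "z = case_nat 0 v"
    define c where "c = mv n B z 0 / w 0"
    have vz: "v = (\<lambda>i. z (Suc i))" by (simp add: z_def)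
    \<comment> \<open>\<open>z\<close> is an eigenvector only modulo \<open>w\<close>. Subtracting
      its projection onto \<open>w\<close> gives \<open>u\<close>, for which the extra multiple of
      \<open>w\<close> drops out of the quadratic form.\<close>
    have Bz: "mv n B z i = x * z i + c * w i" if "i < n" for i
    proof (cases i)
      case 0
      then show ?thesis using w0 by (simp add: z_def c_def)
    next
      case (Suc j)
      then show ?thesis using v(2)[of j] that shift[of z j]
        by (simp add: vz n c_def) (simp add: z_def)
    qed
    define e where "e = dot n z w / dot n w w"
    define u where "u i = z i - e * w i" for i
    have ww: "dot n w w \<noteq> 0" using w0 n by (auto simp: dot_eq_0_iff)
    have uw: "dot n u w = 0" using ww unfolding u_def dot_diff_left dot_scale_left by (simp add: e_def)
    have Bu: "mv n B u i = x * u i + (c + x * e) * w i" if "i < n" for i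
      using Bz[OF that] w[OF that] by (simp add: u_def[abs_def] mv_diff mv_scale algebra_simps)
    have "bform n B u u = dot n u (\<lambda>i. x * u i + (c + x * e) * w i)"
      unfolding bform_def by (intro dot_cong Bu) auto
    also have "\<dots> = x * dot n u u" using uw by (simp add: dot_linear)
    finally have "bform n B y y * dot n u u \<le> x * dot n u u" using min[OF uw] by simp
    moreover have "dot n u u \<noteq> 0"
    proof
      assume "dot n u u = 0"
      then have u0: "\<forall>i<n. u i = 0" by (simp add: dot_eq_0_iff)
      then have "u 0 = 0" using n by auto
      then have "e = 0" using w0 by (simp add: u_def z_def)
      then have "\<forall>i<n. z i = 0" using u0 unfolding u_def by (metis diff_zero mult_zero_left)
      then have "\<forall>i<k. v i = 0" by (simp add: n vz)
      with v(1) show False by auto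
    qed
    ultimately show ?thesis using dot_nonneg[of n u] by (simp add: mult_le_cancel_right)
  qed
  have "eigenvalue ?D (bform n B y y)"
  proof -
    \<comment> \<open>The representative of \<open>y\<close> modulo \<open>w\<close> that vanishes
      at 0. Were it zero, the unit vector \<open>y\<close> would be a multiple of \<open>w\<close>
      and orthogonal to \<open>w\<close> at once.\<close>
    define z where "z i = y i - y 0 / w 0 * w i" for i
    have z0: "z 0 = 0" using w0 by (simp add: z_def)
    have Bz: "mv n B z i = bform n B y y * y i" if "i < n" for i
      using ev[OF that] w[OF that] unfolding z_def mv_diff mv_scale by simp
    have "mv k D (\<lambda>i. z (Suc i)) i = bform n B y y * z (Suc i)" if "i < k" for i
      using shift[of z i, OF z0] Bz[of "Suc i"] Bz[of 0] that n
      by (simp add: z_def algebra_simps)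
    moreover have "\<exists>i<k. z (Suc i) \<noteq> 0"
    proof (rule ccontr)
      assume "\<not> ?thesis"
      then have "z i = 0" if "i < n" for i using z0 that n by (cases i) auto
      then have "y i = y 0 / w 0 * w i" if "i < n" for i
        using that by (simp only: z_def eq_iff_diff_eq_0[of "y i" for i])
      then have "dot n y y = dot n y (\<lambda>i. y 0 / w 0 * w i)" by (rule dot_cong[OF refl])
      also have "\<dots> = y 0 / w 0 * dot n y w" by (rule dot_scale_right)
      finally show False by (simp only: y mult_zero_right)
    qed
    ultimately show ?thesis unfolding eigenvalue_mat_iff
      by (intro exI[of _ "\<lambda>i. z (Suc i)"] conjI allI impI)
  qed
  ultimately have "m = bform n B y y"
    unfolding m_def sorted_eigenvalues_def
  proof (simp only:, intro sorted_list_of_multiset_nth_1)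
    fix x assume "x \<in># proots (char_poly ?D)"
    then have "bform n B y y \<le> x" using le root by blast
    moreover have "0 \<le> bform n B y y" by (rule psd)
    ultimately show "0 \<le> x" "bform n B y y \<le> x" by auto
  qed (auto simp: root le)
  then show ?thesis using y min by (intro that[of y]) auto
qed

section \<open>The spectral gap and insertion of an edge\<close>

definition adj :: "nat set set \<Rightarrow> nat \<Rightarrow> nat \<Rightarrow> real" where
  "adj E i j = (if i \<noteq> j \<and> {i, j} \<in> E then 1 else 0)"

text \<open>The Dirichlet form of \<open>D - A\<close>, kept as a difference because the adjacency
  part is later expanded into mean and noise.\<close>

definition energy :: "nat \<Rightarrow> nat set set \<Rightarrow> (nat \<Rightarrow> real) \<Rightarrow> real" where
  "energy n E x = (\<Sum>i<n. real (degree_of E i) * (x i)\<^sup>2) - bform n (adj E) x x"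

lemma adj_commute: "adj E i j = adj E j i"
  by (simp add: adj_def insert_commute)

lemma finite_vertex_pairs: "finite (vertex_pairs n)"
  unfolding vertex_pairs_def by (rule finite_subset[of _ "Pow {..<n}"]) auto

lemma insert_in_vertex_pairs_iff: "{i, j} \<in> vertex_pairs n \<longleftrightarrow> i < n \<and> j < n \<and> i \<noteq> j"
  by (auto simp: vertex_pairs_def card_2_iff doubleton_eq_iff)

lemma vertex_pairsE:
  assumes "e \<in> vertex_pairs n"
  obtains i j where "e = {i, j}" "i < n" "j < n" "i \<noteq> j"
  using assms by (auto simp: vertex_pairs_def card_2_iff)

lemma degree_of_eq_sum:
  assumes E: "E \<subseteq> vertex_pairs n" and "i < n"
  shows "real (degree_of E i) = (\<Sum>j<n. adj E i j)"
proof -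
  have "bij_betw (\<lambda>j. {i, j}) {j \<in> {..<n}. i \<noteq> j \<and> {i, j} \<in> E} {e \<in> E. i \<in> e}"
  proof (rule bij_betwI')
    fix e assume "e \<in> {e \<in> E. i \<in> e}"
    then have e: "e \<in> E" "i \<in> e" by auto
    then obtain a b where ab: "e = {a, b}" "a < n" "b < n" "a \<noteq> b"
      using E by (blast elim: vertex_pairsE)
    show "\<exists>j\<in>{j \<in> {..<n}. i \<noteq> j \<and> {i, j} \<in> E}. e = {i, j}"
      using e ab by (auto simp: insert_commute)
  qed (auto simp: doubleton_eq_iff)
  then have "degree_of E i = card {j \<in> {..<n}. i \<noteq> j \<and> {i, j} \<in> E}"
    by (simp add: degree_of_def bij_betw_same_card)
  also have "real \<dots> = (\<Sum>j<n. adj E i j)"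
    by (simp add: adj_def flip: sum.inter_filter)
  finally show ?thesis .
qed

lemma energy_eq:
  assumes E: "E \<subseteq> vertex_pairs n"
  shows "energy n E x = (\<Sum>i<n. \<Sum>j<n. adj E i j * (x i - x j)\<^sup>2) / 2"
proof -
  have 1: "(\<Sum>i<n. real (degree_of E i) * (x i)\<^sup>2) = (\<Sum>i<n. \<Sum>j<n. adj E i j * (x i)\<^sup>2)"
    by (intro sum.cong refl) (simp add: degree_of_eq_sum[OF E] sum_distrib_right)
  also have "\<dots> = (\<Sum>i<n. \<Sum>j<n. adj E i j * (x j)\<^sup>2)"
    by (subst sum.swap) (simp add: adj_commute)
  finally have 2: "(\<Sum>i<n. real (degree_of E i) * (x i)\<^sup>2) = (\<Sum>i<n. \<Sum>j<n. adj E i j * (x j)\<^sup>2)" .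
  have "(\<Sum>i<n. \<Sum>j<n. adj E i j * (x i - x j)\<^sup>2) =
      (\<Sum>i<n. \<Sum>j<n. adj E i j * (x i)\<^sup>2) + (\<Sum>i<n. \<Sum>j<n. adj E i j * (x j)\<^sup>2)
      - 2 * bform n (adj E) x x"
    unfolding bform_alt sum_distrib_left sum.distrib[symmetric] sum_subtractf[symmetric]
    by (intro sum.cong refl) (simp add: power2_eq_square algebra_simps)
  then show ?thesis unfolding energy_def using 1 2 by simp
qed

lemma energy_nonneg: "E \<subseteq> vertex_pairs n \<Longrightarrow> 0 \<le> energy n E x"
  by (simp add: energy_eq sum_nonneg adj_def)

lemma energy_shift: "E \<subseteq> vertex_pairs n \<Longrightarrow> energy n E (\<lambda>i. x i - c) = energy n E x"
  by (simp add: energy_eq)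

text \<open>With \<open>r\<close> the square roots of the degrees, the substitution
  \<open>y i = r i * x i\<close> turns the normalized Laplacian form into \<open>energy\<close> and
  orthogonality to the kernel vector \<open>r\<close> into a degree-weighted mean of zero. Positive
  degrees make the substitution invertible.\<close>

theorem spectral_gap_variational:
  assumes E: "E \<subseteq> vertex_pairs n" and n: "2 \<le> n"
    and deg: "\<And>i. i < n \<Longrightarrow> 0 < degree_of E i"
  obtains x where "(\<Sum>i<n. real (degree_of E i) * x i) = 0"
    "(\<Sum>i<n. real (degree_of E i) * (x i)\<^sup>2) = 1" "energy n E x = spectral_gap n E"
    "\<And>z. (\<Sum>i<n. real (degree_of E i) * z i) = 0 \<Longrightarrow>
       spectral_gap n E * (\<Sum>i<n. real (degree_of E i) * (z i)\<^sup>2) \<le> energy n E z"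
proof -
  define r where "r i = sqrt (real (degree_of E i))" for i
  define B where "B i j = (1 / r i) * ((if i = j then real (degree_of E i) else 0) - adj E i j) * (1 / r j)"
    for i j
  have r: "r i > 0" "r i * r i = real (degree_of E i)" if "i < n" for i
    using deg[OF that] by (auto simp: r_def)
  have "degree_matrix n E - adjacency_matrix n E \<in> carrier_mat n n"
    by (intro minus_carrier_mat) (simp add: adjacency_matrix_def)
  then have L: "normalized_laplacian n E = Matrix.mat n n (\<lambda>(i, j). B i j)"
    unfolding normalized_laplacian_def degree_matrix_inv_sqrt_def
    by (subst mat_diag_mult_left, assumption, subst mat_diag_mult_right[of _ n n], simp, intro eq_matI)
      (use deg in \<open>auto simp: degree_matrix_def adjacency_matrix_def mat_diag_def B_def adj_def r_def real_div_sqrt\<close>)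
  have Bform: "bform n B y y = energy n E (\<lambda>i. y i / r i)" for y
  proof -
    have "(\<Sum>j<n. B i j * y i * y j) =
        real (degree_of E i) * (y i / r i)\<^sup>2 - (\<Sum>j<n. adj E i j * (y i / r i) * (y j / r j))"
      if "i < n" for i
    proof -
      have "(\<Sum>j<n. B i j * y i * y j) = (\<Sum>j<n. (if i = j then real (degree_of E i) * (y i / r i)\<^sup>2 else 0)
          - adj E i j * (y i / r i) * (y j / r j))"
        by (intro sum.cong refl) (auto simp: B_def algebra_simps power2_eq_square)
      then show ?thesis using that by (simp add: sum_subtractf)
    qed
    then show ?thesis by (simp add: bform_alt energy_def sum_subtractf)
  qed
  have w: "mv n B r i = 0" if "i < n" for i
  proof -
    have "mv n B r i = (\<Sum>j<n. (1 / r i) * ((if i = j then real (degree_of E i) else 0) - adj E i j))"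
      unfolding mv_def using r by (intro sum.cong refl) (simp add: B_def less_imp_neq[symmetric])
    also have "\<dots> = (1 / r i) * (real (degree_of E i) - (\<Sum>j<n. adj E i j))"
      unfolding sum_distrib_left[symmetric] using that by (simp add: sum_subtractf)
    finally show ?thesis using that by (simp add: degree_of_eq_sum[OF E])
  qed
  have "B i j = B j i" for i j by (simp add: B_def adj_commute)
  moreover have "r 0 \<noteq> 0" using r[of 0] n by auto
  moreover have "0 \<le> bform n B y y" for y unfolding Bform using E by (rule energy_nonneg)
  ultimately obtain y where y: "dot n y r = 0" "dot n y y = 1"
      "bform n B y y = sorted_eigenvalues (Matrix.mat n n (\<lambda>(i, j). B i j)) ! 1"
      "\<And>z. dot n z r = 0 \<Longrightarrow> sorted_eigenvalues (Matrix.mat n n (\<lambda>(i, j). B i j)) ! 1 * dot n z z \<le> bform n B z z"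
    using second_eigenvalue_Rayleigh[of n B r] w n by metis
  have gap: "spectral_gap n E = sorted_eigenvalues (Matrix.mat n n (\<lambda>(i, j). B i j)) ! 1"
    by (simp add: spectral_gap_def L)
  have deg_r: "real (degree_of E i) * (z / r i) = z * r i" "real (degree_of E i) * (z / r i)\<^sup>2 = z * z"
    if "i < n" for i z
    using r[OF that] by (simp_all add: power2_eq_square flip: r(2)[OF that])
  show ?thesis
  proof (rule that[of "\<lambda>i. y i / r i"])
    show "(\<Sum>i<n. real (degree_of E i) * (y i / r i)) = 0"
      using y(1) deg_r by (simp add: dot_def)
    show "(\<Sum>i<n. real (degree_of E i) * (y i / r i)\<^sup>2) = 1"
      using y(2) deg_r by (simp add: dot_def)
    show "energy n E (\<lambda>i. y i / r i) = spectral_gap n E" using y(3) gap by (simp add: Bform)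
    fix z assume z: "(\<Sum>i<n. real (degree_of E i) * z i) = 0"
    define u where "u i = r i * z i" for i
    have "dot n u r = (\<Sum>i<n. real (degree_of E i) * z i)"
      unfolding dot_def by (intro sum.cong refl) (simp add: u_def flip: r(2))
    then have "dot n u r = 0" using z by simp
    moreover have "dot n u u = (\<Sum>i<n. real (degree_of E i) * (z i)\<^sup>2)"
      unfolding dot_def by (intro sum.cong refl) (simp add: u_def power2_eq_square flip: r(2))
    moreover have "u i / r i = z i" if "i < n" for i using r(1)[OF that] by (simp add: u_def)
    then have "bform n B u u = energy n E z" unfolding Bform unfolding energy_def bform_alt by simp
    ultimately show "spectral_gap n E * (\<Sum>i<n. real (degree_of E i) * (z i)\<^sup>2) \<le> energy n E z"
      using y(4)[of u] gap by simp
  qed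
qed

section \<open>Effect of one inserted edge\<close>

lemma degree_of_insert:
  assumes E: "E \<subseteq> vertex_pairs n" and "{u, v} \<notin> E"
  shows "real (degree_of (insert {u, v} E) i) = real (degree_of E i) + (if i = u \<or> i = v then 1 else 0)"
proof -
  have "finite E" using E finite_vertex_pairs finite_subset by blast
  have "{e \<in> insert {u, v} E. i \<in> e} = (if i = u \<or> i = v then insert {u, v} {e \<in> E. i \<in> e} else {e \<in> E. i \<in> e})"
    by auto
  then show ?thesis using assms \<open>finite E\<close> by (simp add: degree_of_def)
qed

lemma energy_insert:
  assumes E: "E \<subseteq> vertex_pairs n" and uv: "u < n" "v < n" "u \<noteq> v" "{u, v} \<notin> E"
  shows "energy n (insert {u, v} E) x = energy n E x + (x u - x v)\<^sup>2"
proof -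
  have "adj (insert {u, v} E) i j = adj E i j + (if i = u then if j = v then 1 else 0 else 0)
      + (if i = v then if j = u then 1 else 0 else 0)" for i j
    using uv by (auto simp: adj_def doubleton_eq_iff insert_commute)
  then have "(\<Sum>i<n. \<Sum>j<n. adj (insert {u, v} E) i j * (x i - x j)\<^sup>2) =
      (\<Sum>i<n. \<Sum>j<n. adj E i j * (x i - x j)\<^sup>2)
      + (\<Sum>i<n. \<Sum>j<n. if i = u then if j = v then (x i - x j)\<^sup>2 else 0 else 0)
      + (\<Sum>i<n. \<Sum>j<n. if i = v then if j = u then (x i - x j)\<^sup>2 else 0 else 0)"
    unfolding sum.distrib[symmetric] by (intro sum.cong refl) (auto simp: algebra_simps)
  also have "(\<Sum>i<n. \<Sum>j<n. if i = u then if j = v then (x i - x j)\<^sup>2 else 0 else 0) =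
      (\<Sum>i<n. if i = u then (\<Sum>j<n. if j = v then (x i - x j)\<^sup>2 else 0) else 0)"
    by (intro sum.cong refl) auto
  also have "\<dots> = (x u - x v)\<^sup>2" using uv by simp
  also have "(\<Sum>i<n. \<Sum>j<n. if i = v then if j = u then (x i - x j)\<^sup>2 else 0 else 0) =
      (\<Sum>i<n. if i = v then (\<Sum>j<n. if j = u then (x i - x j)\<^sup>2 else 0) else 0)"
    by (intro sum.cong refl) auto
  also have "\<dots> = (x u - x v)\<^sup>2" using uv by (simp add: power2_commute)
  finally show ?thesis
    using E uv by (simp add: energy_eq insert_in_vertex_pairs_iff)
qed

text \<open>The test vector is \<open>x\<close>, shifted by a constant to restore orthogonality to the new degrees.\<close>
lemma spectral_gap_insert_le:
  fixes x :: "nat \<Rightarrow> real"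
  assumes E: "E \<subseteq> vertex_pairs n" and n: "2 \<le> n"
    and deg: "\<And>i. i < n \<Longrightarrow> 0 < degree_of E i"
    and uv: "u < n" "v < n" "u \<noteq> v" "{u, v} \<notin> E"
    and x: "(\<Sum>i<n. real (degree_of E i) * x i) = 0"
      "energy n E x \<le> spectral_gap n E * (\<Sum>i<n. real (degree_of E i) * (x i)\<^sup>2)" "x u \<noteq> 0"
    and gap: "spectral_gap n E \<le> 1"
    and good: "(1 - spectral_gap n E + 2 / (\<Sum>i<n. real (degree_of E i))) * ((x u)\<^sup>2 + (x v)\<^sup>2) \<le> 2 * x u * x v"
  shows "spectral_gap n (insert {u, v} E) \<le> spectral_gap n E"
proof -
  let ?G = "insert {u, v} E"
  define D where "D = (\<Sum>i<n. real (degree_of E i))"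
  define l where "l = spectral_gap n E"
  define S where "S = (\<Sum>i<n. real (degree_of E i) * (x i)\<^sup>2)"
  define Q where "Q = (x u)\<^sup>2 + (x v)\<^sup>2"
  \<comment> \<open>The mean of \<open>x\<close> with respect to the new degrees. The old weighted
    sum is 0, so only the two endpoints contribute.\<close>
  define c where "c = (x u + x v) / (D + 2)"
  have G: "?G \<subseteq> vertex_pairs n" using E uv by (simp add: insert_in_vertex_pairs_iff)
  note dG = degree_of_insert[OF E uv(4)]
  have degG: "0 < degree_of ?G i" if "i < n" for i
    using dG[of i] deg[OF that] by (simp split: if_splits)
  have two: "(\<Sum>i<n. (if i = u \<or> i = v then 1 else 0) * f i) = f u + f v" for f :: "nat \<Rightarrow> real"
  proof -
    have "(\<Sum>i<n. (if i = u \<or> i = v then 1 else 0) * f i) =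
        (\<Sum>i<n. (if i = u then f i else 0) + (if i = v then f i else 0))"
      using uv by (intro sum.cong refl) auto
    then show ?thesis using uv by (simp add: sum.distrib)
  qed
  have sumG: "(\<Sum>i<n. real (degree_of ?G i) * f i) = (\<Sum>i<n. real (degree_of E i) * f i) + (f u + f v)"
    for f :: "nat \<Rightarrow> real"
    unfolding dG distrib_right sum.distrib two ..
  have DG: "(\<Sum>i<n. real (degree_of ?G i)) = D + 2"
    using sumG[of "\<lambda>_. 1"] by (simp add: D_def)
  have "{..<n} \<noteq> {}" using n by (metis lessThan_empty_iff not_numeral_le_zero)
  then have "0 < D" unfolding D_def using deg by (intro sum_pos) auto
  have xG: "(\<Sum>i<n. real (degree_of ?G i) * x i) = c * (D + 2)"
    unfolding sumG x(1) using \<open>0 < D\<close> by (simp add: c_def)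
  have z0: "(\<Sum>i<n. real (degree_of ?G i) * (x i - c)) = 0"
    unfolding right_diff_distrib sum_subtractf sum_distrib_right[symmetric] xG DG by simp
  have "(\<Sum>i<n. real (degree_of ?G i) * (x i - c)\<^sup>2) =
      (\<Sum>i<n. real (degree_of ?G i) * (x i)\<^sup>2) - 2 * c * (\<Sum>i<n. real (degree_of ?G i) * x i)
      + c\<^sup>2 * (\<Sum>i<n. real (degree_of ?G i))"
    unfolding sum_distrib_left sum_subtractf[symmetric] sum.distrib[symmetric]
    by (intro sum.cong refl) (simp add: power2_eq_square algebra_simps)
  also have "\<dots> = S + Q - c\<^sup>2 * (D + 2)"
    unfolding xG DG sumG S_def Q_def by (simp add: power2_eq_square algebra_simps)
  finally have SG: "(\<Sum>i<n. real (degree_of ?G i) * (x i - c)\<^sup>2) = S + Q - c\<^sup>2 * (D + 2)" .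
  have EG: "energy n ?G (\<lambda>i. x i - c) = energy n E x + (x u - x v)\<^sup>2"
    unfolding energy_shift[OF G] energy_insert[OF E uv] ..
  have "spectral_gap n ?G * (\<Sum>i<n. real (degree_of ?G i) * (z i)\<^sup>2) \<le> energy n ?G z"
    if "(\<Sum>i<n. real (degree_of ?G i) * z i) = 0" for z
    by (rule spectral_gap_variational[OF G n degG]) (use that in blast)+
  from this[OF z0] have le: "spectral_gap n ?G * (S + Q - c\<^sup>2 * (D + 2)) \<le> l * S + (x u - x v)\<^sup>2"
    unfolding SG EG using x(2) by (simp add: l_def S_def)
  have R: "c\<^sup>2 * (D + 2) = (x u + x v)\<^sup>2 / (D + 2)"
    using \<open>0 < D\<close> by (simp add: c_def power2_eq_square)
  \<comment> \<open>Recentering lowers the weighted square norm by at most \<open>2 / D * Q\<close>;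
    this is the source of the second summand in the criterion \<open>good\<close>.\<close>
  have "(x u + x v)\<^sup>2 \<le> 2 * Q"
    using zero_le_power2[of "x u - x v"] by (simp add: Q_def power2_eq_square algebra_simps)
  then have "c\<^sup>2 * (D + 2) \<le> 2 * Q / (D + 2)"
    unfolding R using \<open>0 < D\<close> by (intro divide_right_mono) auto
  also have "\<dots> \<le> 2 / D * Q"
    using \<open>0 < D\<close> by (simp add: Q_def divide_simps) (simp add: algebra_simps)
  finally have R': "c\<^sup>2 * (D + 2) \<le> 2 / D * Q" .
  have "2 * Q / (D + 2) \<le> Q" using \<open>0 < D\<close> by (simp add: Q_def divide_simps) (simp add: algebra_simps)
  have "0 < S" unfolding S_def
  proof (rule sum_pos2[of _ u])
    show "0 < real (degree_of E u) * (x u)\<^sup>2" using x(3) deg[OF uv(1)] by simp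
  qed (use uv in auto)
  then have pos: "0 < S + Q - c\<^sup>2 * (D + 2)"
    using \<open>c\<^sup>2 * (D + 2) \<le> 2 * Q / (D + 2)\<close> \<open>2 * Q / (D + 2) \<le> Q\<close> by linarith
  have "(1 - l) * (c\<^sup>2 * (D + 2)) \<ge> 0" using gap \<open>0 < D\<close> by (simp add: l_def)
  then have "l * (c\<^sup>2 * (D + 2)) \<le> c\<^sup>2 * (D + 2)" by (simp add: algebra_simps)
  moreover have "(1 - l) * Q + 2 / D * Q \<le> 2 * x u * x v"
    using good by (simp add: l_def D_def Q_def algebra_simps)
  moreover have "(x u - x v)\<^sup>2 = Q - 2 * x u * x v"
    by (simp add: Q_def power2_eq_square algebra_simps)
  \<comment> \<open>The added energy is at most \<open>l\<close> times the added square norm, so the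
    Rayleigh quotient of the test vector does not exceed \<open>l\<close>.\<close>
  ultimately have "(x u - x v)\<^sup>2 \<le> l * (Q - c\<^sup>2 * (D + 2))"
    using R' by (simp add: algebra_simps)
  then have "spectral_gap n ?G * (S + Q - c\<^sup>2 * (D + 2)) \<le> l * (S + Q - c\<^sup>2 * (D + 2))"
    using le by (simp add: algebra_simps)
  then show ?thesis using pos by (simp add: l_def)
qed

section \<open>Quadratic forms on sparse vectors\<close>

lemma bform_add_self:
  assumes "\<And>i j. i < n \<Longrightarrow> j < n \<Longrightarrow> B i j = B j i"
  shows "bform n B (\<lambda>i. u i + v i) (\<lambda>i. u i + v i) = bform n B u u + 2 * bform n B u v + bform n B v v"
    and "bform n B (\<lambda>i. u i - v i) (\<lambda>i. u i - v i) = bform n B u u - 2 * bform n B u v + bform n B v v"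
  using bform_commute[of n B u v, OF assms] by (simp_all add: bform_def dot_linear)

lemma bform_scale:
  "bform n B (\<lambda>i. c * u i) v = c * bform n B u v" "bform n B u (\<lambda>i. c * v i) = c * bform n B u v"
  by (simp_all add: bform_def dot_linear)

lemma bform_cong:
  "(\<And>i. i < n \<Longrightarrow> x i = x' i) \<Longrightarrow> (\<And>i. i < n \<Longrightarrow> y i = y' i) \<Longrightarrow> bform n B x y = bform n B x' y'"
  by (simp add: bform_alt)

lemma bform_zero: "dot n u u = 0 \<Longrightarrow> bform n B u v = 0" "dot n v v = 0 \<Longrightarrow> bform n B u v = 0"
  by (simp_all add: bform_alt dot_eq_0_iff)

text \<open>Polarization and the parallelogram law for normalized vectors. Sums and differences of
  vectors supported on \<open>T\<close> stay supported on \<open>T\<close>, so a bound on the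
  diagonal is enough; \<open>T = UNIV\<close> gives the unrestricted version.\<close>

lemma bform_polarization_bound:
  fixes T :: "nat set"
  assumes sym: "\<And>i j. i < n \<Longrightarrow> j < n \<Longrightarrow> B i j = B j i"
    and Q: "\<And>y. (\<forall>i<n. i \<notin> T \<longrightarrow> y i = 0) \<Longrightarrow> \<bar>bform n B y y\<bar> \<le> Q * dot n y y"
    and u: "\<forall>i<n. i \<notin> T \<longrightarrow> u i = 0" and v: "\<forall>i<n. i \<notin> T \<longrightarrow> v i = 0"
  shows "\<bar>bform n B u v\<bar> \<le> Q * (sqrt (dot n u u) * sqrt (dot n v v))"
proof (cases "dot n u u = 0 \<or> dot n v v = 0")
  case True
  then show ?thesis by (auto simp: bform_zero)
next
  case False
  then have pos: "sqrt (dot n u u) > 0" "sqrt (dot n v v) > 0"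
    using dot_nonneg[of n u] dot_nonneg[of n v] by auto
  define a where "a i = inverse (sqrt (dot n u u)) * u i" for i
  define b where "b i = inverse (sqrt (dot n v v)) * v i" for i
  have norm: "dot n a a = 1" "dot n b b = 1"
    using pos unfolding a_def b_def dot_scale_left dot_scale_right
    by (simp_all add: field_simps flip: power2_eq_square)
  have "\<bar>bform n B (\<lambda>i. a i + b i) (\<lambda>i. a i + b i)\<bar> \<le> Q * dot n (\<lambda>i. a i + b i) (\<lambda>i. a i + b i)"
    "\<bar>bform n B (\<lambda>i. a i - b i) (\<lambda>i. a i - b i)\<bar> \<le> Q * dot n (\<lambda>i. a i - b i) (\<lambda>i. a i - b i)"
    by (rule Q; use u v in \<open>simp add: a_def b_def\<close>)+
  moreover have "bform n B (\<lambda>i. a i + b i) (\<lambda>i. a i + b i) = bform n B a a + 2 * bform n B a b + bform n B b b"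
    by (rule bform_add_self(1)) (rule sym)
  moreover have "bform n B (\<lambda>i. a i - b i) (\<lambda>i. a i - b i) = bform n B a a - 2 * bform n B a b + bform n B b b"
    by (rule bform_add_self(2)) (rule sym)
  ultimately have "\<bar>4 * bform n B a b\<bar> \<le> Q * (2 * dot n a a + 2 * dot n b b)"
    by (simp add: dot_linear dot_commute[of n b a] algebra_simps)
  then have "\<bar>bform n B a b\<bar> \<le> Q" using norm by simp
  then have "\<bar>bform n B a b\<bar> * (sqrt (dot n u u) * sqrt (dot n v v)) \<le> Q * (sqrt (dot n u u) * sqrt (dot n v v))"
    using pos by (intro mult_right_mono) auto
  moreover have "bform n B u v = bform n B a b * (sqrt (dot n u u) * sqrt (dot n v v))"
    unfolding a_def b_def bform_scale using pos by (simp add: divide_simps)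
  ultimately show ?thesis using pos by (simp add: abs_mult)
qed

text \<open>Up to the factor \<open>1 / (4 * sqrt k)\<close> these are the lattice points in the unit ball with at most
  \<open>k\<close> nonzero coordinates; rounding such a vector to the net moves it by at most \<open>1/4\<close>.\<close>
definition lattice_net :: "nat \<Rightarrow> nat \<Rightarrow> (nat \<Rightarrow> int) set" where
  "lattice_net n k = {m \<in> PiE {..<n} (\<lambda>_. {- int (16 * k)..int (16 * k)}).
     card {i. i < n \<and> m i \<noteq> 0} \<le> k \<and> (\<Sum>i<n. (m i)\<^sup>2) \<le> int (16 * k)}"

lemma finite_lattice_net: "finite (lattice_net n k)"
proof (rule finite_subset)
  show "lattice_net n k \<subseteq> PiE {..<n} (\<lambda>_. {- int (16 * k)..int (16 * k)})"
    unfolding lattice_net_def by (rule Collect_subset)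
qed (intro finite_PiE; simp)

text \<open>An integer is bounded in absolute value by its square, so the bound on the sum of
  squares forces every coordinate into the box.\<close>

lemma restrict_in_lattice_net:
  assumes "card {i. i < n \<and> m i \<noteq> 0} \<le> k" "(\<Sum>i<n. (m i)\<^sup>2) \<le> int (16 * k)"
  shows "restrict m {..<n} \<in> lattice_net n k"
proof -
  have "\<bar>m i\<bar> \<le> int (16 * k)" if "i < n" for i
  proof -
    have "\<bar>m i\<bar> \<le> (m i)\<^sup>2"
    proof (cases "m i = 0")
      case False
      then have "\<bar>m i\<bar> * 1 \<le> \<bar>m i\<bar> * \<bar>m i\<bar>" by (intro mult_left_mono) auto
      then show ?thesis by (simp add: power2_eq_square abs_mult_self_eq)
    qed simp
    also have "\<dots> \<le> (\<Sum>i<n. (m i)\<^sup>2)" using that by (intro member_le_sum) auto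
    finally show ?thesis using assms(2) by linarith
  qed
  then have "restrict m {..<n} \<in> PiE {..<n} (\<lambda>_. {- int (16 * k)..int (16 * k)})"
    by (auto simp: abs_le_iff) (smt (verit))+
  moreover have "{i. i < n \<and> restrict m {..<n} i \<noteq> 0} = {i. i < n \<and> m i \<noteq> 0}" by auto
  ultimately show ?thesis using assms by (simp add: lattice_net_def)
qed

text \<open>The bound is a partial geometric sum so that the induction closes:
  \<open>exp (- a^2) \<le> exp (- a) \<le> (1/2)^a\<close> for natural \<open>a\<close>, and the two
  new terms are equal by symmetry.\<close>

lemma exp_square_sum_le:
  fixes x :: real
  assumes "0 < x"
  shows "(\<Sum>a\<in>{- int L..int L}. if a = 0 then 1 else x * exp (- (real_of_int a)\<^sup>2)) \<le> 1 + 2 * x * (1 - (1/2) ^ L)"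
proof (induction L)
  case 0
  then show ?case by simp
next
  case (Suc L)
  let ?g = "\<lambda>a. if a = 0 then 1 else x * exp (- (real_of_int a)\<^sup>2)"
  have "{- int (Suc L)..int (Suc L)} = insert (- int (Suc L)) (insert (int (Suc L)) {- int L..int L})"
    by auto
  moreover have "(- 1 - real L)\<^sup>2 = (1 + real L)\<^sup>2"
    by (simp add: power2_eq_square algebra_simps)
  ultimately have "sum ?g {- int (Suc L)..int (Suc L)} = 2 * x * exp (- (real (Suc L))\<^sup>2) + sum ?g {- int L..int L}"
    by (simp add: algebra_simps)
  moreover have "exp (- (real (Suc L))\<^sup>2) \<le> (1/2) ^ Suc L"
  proof -
    have "real (Suc L) \<le> (real (Suc L))\<^sup>2" by (simp add: power2_eq_square)
    then have "exp (- (real (Suc L))\<^sup>2) \<le> exp (real (Suc L) * (-1))" by simp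
    also have "\<dots> = exp (-1) ^ Suc L" by (rule exp_of_nat_mult)
    also have "\<dots> \<le> (1/2) ^ Suc L"
    proof (rule power_mono)
      show "exp (-1) \<le> (1/2 :: real)" using exp_ge_add_one_self[of 1] by (simp add: exp_minus field_simps)
    qed simp
    finally show ?thesis .
  qed
  then have "2 * x * exp (- (real (Suc L))\<^sup>2) \<le> 2 * x * (1/2) ^ Suc L" using assms by simp
  ultimately show ?case using Suc.IH by (simp add: algebra_simps)
qed

text \<open>Comparison with the generating function \<open>(\<Sum>a. x\<^bsup>[a \<noteq> 0]\<^esup> e\<^bsup>-a\<^sup>2\<^esup>)\<^sup>n\<close>; the parameter \<open>x\<close> is tuned to the sparsity.\<close>
lemma card_lattice_net:
  fixes x :: real
  assumes x: "0 < x" "x \<le> 1"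
  shows "real (card (lattice_net n k)) \<le> exp (real k * (16 + ln (1 / x)) + 2 * x * real n)"
proof -
  define g where "g a = (if a = 0 then 1 else x * exp (- (real_of_int a)\<^sup>2))" for a :: int
  have g: "0 \<le> g a" for a using x by (simp add: g_def)
  \<comment> \<open>Every net point has at least this weight: sparsity gives \<open>x ^ k\<close>
    because \<open>x \<le> 1\<close>, and the norm bound gives the exponential. The cardinality is
    thus at most the total weight of the box divided by it, and the total weight factorizes over the
    coordinates.\<close>
  have "x ^ k * exp (- real (16 * k)) \<le> (\<Prod>i<n. g (m i))" if m: "m \<in> lattice_net n k" for m
  proof -
    let ?S = "{i. i < n \<and> m i \<noteq> 0}"
    have "(\<Prod>i<n. g (m i)) = (\<Prod>i<n. (if m i \<noteq> 0 then x else 1) * exp (- (real_of_int (m i))\<^sup>2))"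
      by (intro prod.cong) (auto simp: g_def)
    also have "\<dots> = x ^ card ?S * exp (- (\<Sum>i<n. (real_of_int (m i))\<^sup>2))"
    proof -
      have "(\<Prod>i<n. (if m i \<noteq> 0 then x else 1)) = x ^ card ?S"
        by (subst prod.inter_filter[symmetric]) (auto intro!: arg_cong[where f = "\<lambda>A. x ^ card A"])
      then show ?thesis by (simp add: prod.distrib exp_sum flip: sum_negf)
    qed
    also have "\<dots> \<ge> x ^ k * exp (- real (16 * k))"
    proof (intro mult_mono)
      show "x ^ k \<le> x ^ card ?S" using m x by (intro power_decreasing) (auto simp: lattice_net_def)
      have "(\<Sum>i<n. (m i)\<^sup>2) \<le> int (16 * k)" using m by (simp add: lattice_net_def)
      then have "real_of_int (\<Sum>i<n. (m i)\<^sup>2) \<le> real_of_int (int (16 * k))" by (simp only: of_int_le_iff)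
      then show "exp (- real (16 * k)) \<le> exp (- (\<Sum>i<n. (real_of_int (m i))\<^sup>2))" by simp
    qed (use x in auto)
    finally show ?thesis .
  qed
  then have "real (card (lattice_net n k)) * (x ^ k * exp (- real (16 * k))) \<le> (\<Sum>m\<in>lattice_net n k. \<Prod>i<n. g (m i))"
    using sum_bounded_below[of "lattice_net n k" "x ^ k * exp (- real (16 * k))"] by simp
  also have "\<dots> \<le> (\<Sum>m\<in>PiE {..<n} (\<lambda>_. {- int (16 * k)..int (16 * k)}). \<Prod>i<n. g (m i))"
    by (intro sum_mono2 finite_PiE prod_nonneg) (auto simp: lattice_net_def g)
  also have "\<dots> = (\<Prod>i<n. \<Sum>a\<in>{- int (16 * k)..int (16 * k)}. g a)"
    by (rule prod_sum_PiE[symmetric]) auto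
  also have "\<dots> \<le> (\<Prod>i<n. exp (2 * x))"
  proof (intro prod_mono conjI sum_nonneg g)
    have "(\<Sum>a\<in>{- int (16 * k)..int (16 * k)}. g a) \<le> 1 + 2 * x * (1 - (1/2) ^ (16 * k))"
      unfolding g_def by (rule exp_square_sum_le[OF x(1)])
    also have "\<dots> \<le> 1 + 2 * x * 1" using x by (intro add_left_mono mult_left_mono) auto
    also have "\<dots> \<le> exp (2 * x)" using exp_ge_add_one_self[of "2 * x"] by simp
    finally show "(\<Sum>a\<in>{- int (16 * k)..int (16 * k)}. g a) \<le> exp (2 * x)" .
  qed
  also have "\<dots> = exp (2 * x * real n)" by (simp add: mult.commute flip: exp_of_nat_mult)
  finally have "real (card (lattice_net n k)) \<le> exp (2 * x * real n) / (x ^ k * exp (- real (16 * k)))"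
    using x by (simp add: field_simps)
  also have "x ^ k = exp (- (real k * ln (1 / x)))"
    using x by (simp add: ln_div exp_of_nat_mult)
  also have "exp (2 * x * real n) / (exp (- (real k * ln (1 / x))) * exp (- real (16 * k))) =
      exp (real k * (16 + ln (1 / x)) + 2 * x * real n)"
    by (simp add: exp_diff[symmetric] exp_add[symmetric] algebra_simps)
  finally show ?thesis .
qed

text \<open>Bootstrapping. Let \<open>Q\<close> be the supremum of the form over the unit ball of
  vectors supported where \<open>y\<close> is. Rounding to the net leaves an error of norm at most
  1/4 inside that support, so \<open>Q \<le> t + 2 * (Q / 4) + Q / 16\<close>, hence
  \<open>Q \<le> 16 / 7 * t \<le> 3 * t\<close>.\<close>

lemma bform_bound_from_net:
  assumes sym: "\<And>i j. i < n \<Longrightarrow> j < n \<Longrightarrow> B i j = B j i" and "1 \<le> k"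
    and net: "\<And>m. m \<in> lattice_net n k \<Longrightarrow>
      \<bar>bform n B (\<lambda>i. real_of_int (m i)) (\<lambda>i. real_of_int (m i))\<bar> \<le> 16 * real k * t"
    and sparse: "card {i. i < n \<and> y i \<noteq> 0} \<le> k"
  shows "\<bar>bform n B y y\<bar> \<le> 3 * t * dot n y y"
proof -
  define T where "T = {i. i < n \<and> y i \<noteq> 0}"
  have "finite T" "card T \<le> k" using sparse by (auto simp: T_def)
  define W where "W = {u. (\<forall>i<n. i \<notin> T \<longrightarrow> u i = 0) \<and> dot n u u \<le> 1}"
  define Q where "Q = (SUP u\<in>W. \<bar>bform n B u u\<bar>)"
  \<comment> \<open>A crude bound whose purpose is that the supremum ranges over a bounded set and
    so is a genuine one.\<close>
  have W_le: "\<bar>bform n B u u\<bar> \<le> (\<Sum>i<n. \<Sum>j<n. \<bar>B i j\<bar>)" if "u \<in> W" for u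
  proof -
    have u1: "\<bar>u i\<bar> \<le> 1" if "i < n" for i
    proof -
      have "u i * u i \<le> dot n u u" unfolding dot_def using that by (intro member_le_sum) auto
      then have "(u i)\<^sup>2 \<le> 1" using \<open>u \<in> W\<close> by (simp add: W_def power2_eq_square)
      then show ?thesis by (simp add: abs_square_le_1)
    qed
    have "\<bar>bform n B u u\<bar> \<le> (\<Sum>i<n. \<Sum>j<n. \<bar>B i j * u i * u j\<bar>)"
      unfolding bform_alt by (intro order_trans[OF sum_abs] sum_mono order_trans[OF sum_abs]) auto
    also have "\<dots> \<le> (\<Sum>i<n. \<Sum>j<n. \<bar>B i j\<bar>)"
    proof (intro sum_mono)
      fix i j assume "i \<in> {..<n}" "j \<in> {..<n}"
      then have "\<bar>u i\<bar> * \<bar>u j\<bar> \<le> 1 * 1" using u1 by (intro mult_mono) auto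
      then have "\<bar>B i j\<bar> * (\<bar>u i\<bar> * \<bar>u j\<bar>) \<le> \<bar>B i j\<bar> * 1" by (intro mult_left_mono) auto
      then show "\<bar>B i j * u i * u j\<bar> \<le> \<bar>B i j\<bar>" by (simp add: abs_mult mult.assoc)
    qed
    finally show ?thesis .
  qed
  have bdd: "bdd_above ((\<lambda>u. \<bar>bform n B u u\<bar>) ` W)" using W_le by (intro bdd_aboveI2) blast
  have QW: "\<bar>bform n B u u\<bar> \<le> Q" if "u \<in> W" for u
    unfolding Q_def by (rule cSUP_upper[OF that bdd])
  have Q: "\<bar>bform n B u u\<bar> \<le> Q * dot n u u" if u: "\<forall>i<n. i \<notin> T \<longrightarrow> u i = 0" for u
  proof (cases "dot n u u = 0")
    case True
    then show ?thesis by (simp add: bform_zero)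
  next
    case False
    then have pos: "dot n u u > 0" using dot_nonneg[of n u] by linarith
    define c where "c = inverse (sqrt (dot n u u))"
    have c: "c * c = inverse (dot n u u)" using pos by (simp add: c_def flip: inverse_mult_distrib)
    have "dot n (\<lambda>i. c * u i) (\<lambda>i. c * u i) = 1"
      using pos c by (simp add: dot_linear flip: mult.assoc)
    then have "(\<lambda>i. c * u i) \<in> W" using u by (simp add: W_def)
    from QW[OF this] have "\<bar>(c * c) * bform n B u u\<bar> \<le> Q" by (simp add: bform_scale mult.assoc)
    then show ?thesis using pos unfolding c by (simp add: abs_mult field_simps)
  qed
  have step: "\<bar>bform n B u u\<bar> \<le> t + 9 / 16 * Q" if "u \<in> W" for u
  proof -
    \<comment> \<open>With mesh \<open>1 / s\<close>, rounding at most \<open>k\<close> coordinates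
      costs a squared error of at most \<open>k / s^2 = 1 / 16\<close>.\<close>
    define s where "s = 4 * sqrt (real k)"
    have s: "s > 0" "s * s = 16 * real k" using \<open>1 \<le> k\<close> by (simp_all add: s_def)
    \<comment> \<open>Rounding towards 0 enlarges neither the support nor the norm, as membership in
      the net requires.\<close>
    define m where "m i = (if 0 \<le> u i then \<lfloor>s * u i\<rfloor> else - \<lfloor>- (s * u i)\<rfloor>)" for i
    have u0: "u i = 0" if "i < n" "i \<notin> T" for i using \<open>u \<in> W\<close> that by (simp add: W_def)
    have m_le: "\<bar>real_of_int (m i)\<bar> \<le> \<bar>s * u i\<bar>" and m_diff: "\<bar>s * u i - real_of_int (m i)\<bar> \<le> 1" for i
    proof -
      define f where "f = \<lfloor>\<bar>s * u i\<bar>\<rfloor>"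
      have f: "0 \<le> real_of_int f" "real_of_int f \<le> \<bar>s * u i\<bar>" "\<bar>s * u i\<bar> \<le> real_of_int f + 1"
        by (simp_all add: f_def)
      show "\<bar>real_of_int (m i)\<bar> \<le> \<bar>s * u i\<bar>" "\<bar>s * u i - real_of_int (m i)\<bar> \<le> 1"
      proof (atomize (full), cases "0 \<le> u i")
        case True
        then have "\<bar>s * u i\<bar> = s * u i" "m i = f" using s by (simp_all add: m_def f_def)
        then show "\<bar>real_of_int (m i)\<bar> \<le> \<bar>s * u i\<bar> \<and> \<bar>s * u i - real_of_int (m i)\<bar> \<le> 1"
          using f by simp
      next
        case False
        then have "s * u i < 0" using s by (simp add: mult_pos_neg)
        then have "\<bar>s * u i\<bar> = - (s * u i)" "m i = - f" using False by (simp_all add: m_def f_def)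
        then show "\<bar>real_of_int (m i)\<bar> \<le> \<bar>s * u i\<bar> \<and> \<bar>s * u i - real_of_int (m i)\<bar> \<le> 1"
          using f by simp
      qed
    qed
    have m0: "m i = 0" if "i < n" "i \<notin> T" for i using u0[OF that] by (simp add: m_def)
    let ?m = "\<lambda>i. real_of_int (m i)"
    have uu: "dot n u u \<le> 1" using \<open>u \<in> W\<close> by (simp add: W_def)
    have mm: "dot n ?m ?m \<le> 16 * real k"
    proof -
      have "dot n ?m ?m \<le> (\<Sum>i<n. (s * u i) * (s * u i))"
        unfolding dot_def
      proof (intro sum_mono)
        fix i
        have "\<bar>?m i\<bar> * \<bar>?m i\<bar> \<le> \<bar>s * u i\<bar> * \<bar>s * u i\<bar>" using m_le by (intro mult_mono) auto
        then show "?m i * ?m i \<le> (s * u i) * (s * u i)" by (simp only: abs_mult_self_eq)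
      qed
      also have "\<dots> = (s * s) * dot n u u" by (simp add: dot_def sum_distrib_left algebra_simps)
      also have "\<dots> \<le> (s * s) * 1" using uu s by (intro mult_left_mono) auto
      finally show ?thesis using s by simp
    qed
    have "restrict m {..<n} \<in> lattice_net n k"
    proof (rule restrict_in_lattice_net)
      have "card {i. i < n \<and> m i \<noteq> 0} \<le> card T"
        using m0 \<open>finite T\<close> by (intro card_mono) auto
      then show "card {i. i < n \<and> m i \<noteq> 0} \<le> k" using \<open>card T \<le> k\<close> by simp
      have "real_of_int (\<Sum>i<n. (m i)\<^sup>2) \<le> real_of_int (int (16 * k))"
        using mm by (simp add: dot_def power2_eq_square)
      then show "(\<Sum>i<n. (m i)\<^sup>2) \<le> int (16 * k)" by (simp only: of_int_le_iff)
    qed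
    from net[OF this] have net_m: "\<bar>bform n B ?m ?m\<bar> \<le> s * s * t"
      unfolding s(2) by (simp cong: bform_cong)
    define z where "z i = inverse s * ?m i" for i
    define r where "r i = u i - z i" for i
    have zz: "dot n z z \<le> 1"
      using mm s(1) unfolding z_def dot_linear s(2)[symmetric] by (simp add: field_simps)
    have "bform n B z z = bform n B ?m ?m / (s * s)"
      unfolding z_def bform_scale using s by (simp add: field_simps)
    then have bz: "\<bar>bform n B z z\<bar> \<le> t" using net_m s(1) by (simp add: abs_mult divide_le_eq mult.commute)
    have "dot n r r = (\<Sum>i\<in>T. r i * r i)" unfolding dot_def
      by (intro sum.mono_neutral_right) (auto simp: T_def r_def z_def u0[unfolded T_def] m0[unfolded T_def])
    also have "\<dots> \<le> (\<Sum>i\<in>T. inverse s * inverse s)"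
    proof (intro sum_mono)
      fix i
      have "r i = inverse s * (s * u i - ?m i)" using s by (simp add: r_def z_def algebra_simps)
      then have "\<bar>r i\<bar> \<le> inverse s * 1" using m_diff[of i] s(1)
        by (simp only: abs_mult) (intro mult_mono, auto)
      then have "\<bar>r i\<bar> * \<bar>r i\<bar> \<le> inverse s * inverse s" using s(1) by (intro mult_mono) auto
      then show "r i * r i \<le> inverse s * inverse s" by (simp only: abs_mult_self_eq)
    qed
    also have "\<dots> = real (card T) / (16 * real k)" using s by (simp add: field_simps)
    also have "\<dots> \<le> real k / (16 * real k)" using \<open>card T \<le> k\<close> by (intro divide_right_mono) auto
    also have "\<dots> = (1/4)\<^sup>2" using \<open>1 \<le> k\<close> by (simp add: power2_eq_square)
    finally have rr: "dot n r r \<le> (1/4)\<^sup>2" .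
    then have sr: "sqrt (dot n r r) \<le> 1/4" by (intro real_le_lsqrt) auto
    have zT: "\<forall>i<n. i \<notin> T \<longrightarrow> z i = 0" and rT: "\<forall>i<n. i \<notin> T \<longrightarrow> r i = 0"
      using m0 u0 by (auto simp: z_def r_def)
    have "0 \<le> Q" using QW[of "\<lambda>_. 0"] by (simp add: W_def dot_def bform_alt)
    have "\<bar>bform n B z r\<bar> \<le> Q * (sqrt (dot n z z) * sqrt (dot n r r))"
      by (rule bform_polarization_bound[OF sym Q zT rT])
    also have "\<dots> \<le> Q * (1 * (1/4))"
      using \<open>0 \<le> Q\<close> zz sr dot_nonneg[of n r] by (intro mult_left_mono mult_mono) auto
    finally have zr: "\<bar>bform n B z r\<bar> \<le> Q / 4" by simp
    have "\<bar>bform n B r r\<bar> \<le> Q * dot n r r" by (rule Q[OF rT])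
    also have "\<dots> \<le> Q * (1/4)\<^sup>2" using rr \<open>0 \<le> Q\<close> by (intro mult_left_mono) auto
    finally have br: "\<bar>bform n B r r\<bar> \<le> Q / 16" by (simp add: power2_eq_square)
    have "bform n B u u = bform n B z z + 2 * bform n B z r + bform n B r r"
      using bform_add_self(1)[of n B z r, OF sym] by (simp add: r_def)
    then show ?thesis using bz zr br by linarith
  qed
  have "(\<lambda>_. 0) \<in> W" by (simp add: W_def dot_def)
  then have "Q \<le> t + 9 / 16 * Q" unfolding Q_def[symmetric]
    by (subst Q_def, intro cSUP_least) (use step in \<open>auto simp: Q_def\<close>)
  moreover have "0 \<le> Q" using QW[OF \<open>(\<lambda>_. 0) \<in> W\<close>] by linarith
  ultimately have "Q \<le> 3 * t" by linarith
  have "\<bar>bform n B y y\<bar> \<le> Q * dot n y y" by (rule Q) (simp add: T_def)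
  also have "\<dots> \<le> 3 * t * dot n y y" using \<open>Q \<le> 3 * t\<close> dot_nonneg by (intro mult_right_mono)
  finally show ?thesis .
qed

section \<open>Concentration\<close>

lemma set_pmf_gnp: "set_pmf (gnp n p) \<subseteq> Pow (vertex_pairs n)"
proof -
  have "set_pmf (Pi_pmf (vertex_pairs n) False (\<lambda>_. bernoulli_pmf p)) \<subseteq> {f. \<forall>x. x \<notin> vertex_pairs n \<longrightarrow> f x = False}"
    by (rule set_Pi_pmf_subset[OF finite_vertex_pairs])
  then show ?thesis by (auto simp: gnp_def)
qed

lemma pmf_gnp:
  assumes E: "E \<subseteq> vertex_pairs n" and p: "0 < p" "p < 1"
  shows "pmf (gnp n p) E = (\<Prod>e\<in>vertex_pairs n. if e \<in> E then p else 1 - p)"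
proof -
  have "inj (\<lambda>f. {e. f e} :: nat set set)" by (auto simp: inj_def fun_eq_iff)
  then have "pmf (gnp n p) {e. e \<in> E} = pmf (Pi_pmf (vertex_pairs n) False (\<lambda>_. bernoulli_pmf p)) (\<lambda>e. e \<in> E)"
    unfolding gnp_def by (rule pmf_map_inj')
  also have "\<dots> = (\<Prod>e\<in>vertex_pairs n. pmf (bernoulli_pmf p) (e \<in> E))"
    using E by (intro pmf_Pi' finite_vertex_pairs) auto
  also have "\<dots> = (\<Prod>e\<in>vertex_pairs n. if e \<in> E then p else 1 - p)"
    using p by (intro prod.cong) auto
  finally show ?thesis by simp
qed

lemma prob_gnp_eq_sum: "measure_pmf.prob (gnp n p) A = (\<Sum>E\<in>A \<inter> Pow (vertex_pairs n). pmf (gnp n p) E)"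
proof -
  have "measure_pmf.prob (gnp n p) A = measure_pmf.prob (gnp n p) (A \<inter> Pow (vertex_pairs n))"
    by (rule measure_prob_cong_0) (use set_pmf_gnp[of n p] in \<open>auto simp: pmf_eq_0_set_pmf\<close>)
  then show ?thesis by (simp add: measure_measure_pmf_finite finite_vertex_pairs)
qed

text \<open>Deleting \<open>e\<close> is a bijection from the graphs containing \<open>e\<close> to
  those avoiding it, and it changes a single factor of the product weight from \<open>p\<close> to
  \<open>1 - p\<close>.\<close>

lemma prob_gnp_edge_swap:
  assumes e: "e \<in> vertex_pairs n" and p: "0 < p" "p < 1"
  shows "measure_pmf.prob (gnp n p) {E. e \<in> E \<and> P (E - {e})} =
    p / (1 - p) * measure_pmf.prob (gnp n p) {E. e \<notin> E \<and> P E}"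
proof -
  let ?V = "vertex_pairs n"
  have "(\<Sum>E\<in>{E. e \<in> E \<and> P (E - {e})} \<inter> Pow ?V. pmf (gnp n p) E) =
      (\<Sum>E\<in>{E. e \<notin> E \<and> P E} \<inter> Pow ?V. p / (1 - p) * pmf (gnp n p) E)"
  proof (rule sum.reindex_bij_witness[of _ "insert e" "\<lambda>E. E - {e}"])
    fix E assume E: "E \<in> {E. e \<in> E \<and> P (E - {e})} \<inter> Pow ?V"
    have split: "pmf (gnp n p) F = (if e \<in> F then p else 1 - p) * (\<Prod>d\<in>?V - {e}. if d \<in> F then p else 1 - p)"
      if "F \<subseteq> ?V" for F
      using e finite_vertex_pairs by (simp add: pmf_gnp[OF that p] prod.remove[of ?V e])
    have "(\<Prod>d\<in>?V - {e}. if d \<in> E then p else 1 - p) = (\<Prod>d\<in>?V - {e}. if d \<in> E - {e} then p else 1 - p)"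
      by (intro prod.cong) auto
    then show "p / (1 - p) * pmf (gnp n p) (E - {e}) = pmf (gnp n p) E"
      using E p by (subst (1 2) split) auto
  qed (use e in \<open>auto simp: insert_absorb\<close>)
  then show ?thesis unfolding prob_gnp_eq_sum by (simp add: sum_distrib_left)
qed

text \<open>Hoeffding with ranges of length \<open>\<bar>w e\<bar>\<close>. The upper bound
  \<open>V\<close> spares callers the exact sum of squares; if all weights vanish, the event is
  empty because \<open>0 < t\<close>.\<close>

lemma Hoeffding_gnp:
  fixes w :: "nat set \<Rightarrow> real"
  assumes p: "0 < p" "p < 1" and V: "(\<Sum>e\<in>vertex_pairs n. (w e)\<^sup>2) \<le> V" and "0 < V" "0 < t"
  shows "measure_pmf.prob (gnp n p)
      {E. t \<le> \<bar>\<Sum>e\<in>vertex_pairs n. w e * ((if e \<in> E then 1 else 0) - p)\<bar>} \<le> 2 * exp (- 2 * t\<^sup>2 / V)"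
proof (cases "(\<Sum>e\<in>vertex_pairs n. (w e)\<^sup>2) = 0")
  case True
  then have "w e = 0" if "e \<in> vertex_pairs n" for e
    using that by (subst (asm) sum_nonneg_eq_0_iff) (auto simp: finite_vertex_pairs)
  then show ?thesis using \<open>0 < t\<close> by simp
next
  case False
  then have pos: "0 < (\<Sum>e\<in>vertex_pairs n. (w e)\<^sup>2)"
    using sum_nonneg[of "vertex_pairs n" "\<lambda>e. (w e)\<^sup>2"] by simp
  let ?M = "Pi_pmf (vertex_pairs n) False (\<lambda>_. bernoulli_pmf p)"
  define X where "X e f = w e * ((if f e then 1 else 0) - p)" for e and f :: "nat set \<Rightarrow> bool"
  define a where "a e = min (- (w e * p)) (w e * (1 - p))" for e
  define b where "b e = max (- (w e * p)) (w e * (1 - p))" for e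
  have ab: "(b e - a e)\<^sup>2 = (w e)\<^sup>2" for e
    by (auto simp: a_def b_def min_def max_def algebra_simps power2_eq_square)
  have expX: "measure_pmf.expectation ?M (X e) = 0" if "e \<in> vertex_pairs n" for e
  proof -
    have "measure_pmf.expectation ?M (X e) =
        measure_pmf.expectation (map_pmf (\<lambda>f. f e) ?M) (\<lambda>c. w e * ((if c then 1 else 0) - p))"
      by (simp add: X_def[abs_def])
    also have "map_pmf (\<lambda>f. f e) ?M = bernoulli_pmf p"
      using that by (simp add: Pi_pmf_component finite_vertex_pairs)
    finally show ?thesis using p by (simp add: algebra_simps)
  qed
  interpret Hoeffding_ineq ?M "vertex_pairs n" X a b "\<Sum>e\<in>vertex_pairs n. measure_pmf.expectation ?M (X e)"
  proof unfold_locales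
    have "prob_space.indep_vars ?M (\<lambda>_. count_space UNIV) (\<lambda>e f. f e) (vertex_pairs n)"
      by (rule indep_vars_Pi_pmf[OF finite_vertex_pairs])
    then show "prob_space.indep_vars ?M (\<lambda>_. borel) X (vertex_pairs n)"
      unfolding X_def[abs_def] by (rule prob_space.indep_vars_compose2[OF prob_space_measure_pmf]) auto
    show "AE x in ?M. X i x \<in> {a i..b i}" for i
      by (intro AE_I2) (auto simp: X_def a_def b_def min_def max_def)
  qed (auto simp: finite_vertex_pairs)
  have "measure_pmf.prob (gnp n p) {E. t \<le> \<bar>\<Sum>e\<in>vertex_pairs n. w e * ((if e \<in> E then 1 else 0) - p)\<bar>} =
      measure_pmf.prob ?M {f \<in> space ?M. t \<le> \<bar>(\<Sum>e\<in>vertex_pairs n. X e f) - (\<Sum>e\<in>vertex_pairs n. measure_pmf.expectation ?M (X e))\<bar>}"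
    by (simp add: expX) (simp add: gnp_def vimage_def X_def)
  also have "\<dots> \<le> 2 * exp (- 2 * t\<^sup>2 / (\<Sum>e\<in>vertex_pairs n. (b e - a e)\<^sup>2))"
    using pos \<open>0 < t\<close> by (intro Hoeffding_ineq_abs_ge) (auto simp: ab)
  also have "\<dots> \<le> 2 * exp (- 2 * t\<^sup>2 / V)"
  proof -
    have "2 * t\<^sup>2 / V \<le> 2 * t\<^sup>2 / (\<Sum>e\<in>vertex_pairs n. (w e)\<^sup>2)"
      using V pos by (intro divide_left_mono) auto
    then show ?thesis by (simp add: ab)
  qed
  finally show ?thesis .
qed

text \<open>Passes from matrix sums, where symmetric entries are the same random variable, to sums
  over independent edges.\<close>

lemma sum_off_diagonal:
  fixes f :: "nat set \<Rightarrow> real"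
  shows "(\<Sum>i<n. \<Sum>j<n. if i = j then 0 else f {i, j}) = 2 * (\<Sum>e\<in>vertex_pairs n. f e)"
proof -
  have bij: "bij_betw (\<lambda>(i, j). {i, j}) {(i, j). i < j \<and> j < n} (vertex_pairs n)"
  proof (rule bij_betwI')
    fix e assume "e \<in> vertex_pairs n"
    then obtain i j where e: "e = {i, j}" "i < n" "j < n" "i \<noteq> j" by (rule vertex_pairsE)
    have "e = {min i j, max i j}" "min i j < max i j" "max i j < n"
      using e by (auto simp: min_def max_def)
    then show "\<exists>x\<in>{(i, j). i < j \<and> j < n}. e = (\<lambda>(i, j). {i, j}) x"
      by (intro bexI[of _ "(min i j, max i j)"]) auto
  qed (auto simp: insert_in_vertex_pairs_iff doubleton_eq_iff)
  have fin: "finite {(i, j). i < j \<and> j < n}"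
    by (rule finite_subset[of _ "{..<n} \<times> {..<n}"]) auto
  have half: "(\<Sum>e\<in>vertex_pairs n. f e) = (\<Sum>(i, j)\<in>{(i, j). i < j \<and> j < n}. f {i, j})"
    using sum.reindex_bij_betw[OF bij, of f] by (simp add: case_prod_unfold)
  have half': "(\<Sum>(i, j)\<in>{(i, j). i < j \<and> j < n}. f {i, j}) = (\<Sum>(i, j)\<in>{(i, j). j < i \<and> i < n}. f {i, j})"
    by (rule sum.reindex_bij_witness[of _ "\<lambda>(i, j). (j, i)" "\<lambda>(i, j). (j, i)"]) (auto simp: insert_commute)
  have "(\<Sum>i<n. \<Sum>j<n. if i = j then 0 else f {i, j}) =
      (\<Sum>(i, j)\<in>{..<n} \<times> {..<n}. if i = j then 0 else f {i, j})"
    by (rule sum.cartesian_product)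
  also have "\<dots> = (\<Sum>(i, j)\<in>{(i, j). i < j \<and> j < n} \<union> {(i, j). j < i \<and> i < n}. f {i, j})"
    by (rule sum.mono_neutral_cong_right) (auto simp: not_less order.order_iff_strict)
  also have "\<dots> = (\<Sum>(i, j)\<in>{(i, j). i < j \<and> j < n}. f {i, j}) + (\<Sum>(i, j)\<in>{(i, j). j < i \<and> i < n}. f {i, j})"
    by (rule sum.union_disjoint) (use fin in \<open>auto intro: finite_subset[of _ "{..<n} \<times> {..<n}"]\<close>)
  finally show ?thesis using half half' by simp
qed

text \<open>The diagonal is 0 and not \<open>- p\<close>, so the form contains centered edge
  variables only. Correspondingly the mean being subtracted is \<open>p * (J - I)\<close>, with
  \<open>J\<close> the all-ones matrix.\<close>

definition noise :: "real \<Rightarrow> nat set set \<Rightarrow> nat \<Rightarrow> nat \<Rightarrow> real" where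
  "noise p E i j = (if i = j then 0 else adj E i j - p)"

lemma noise_commute: "noise p E i j = noise p E j i"
  by (simp add: noise_def adj_commute)

text \<open>The product over the two-element set \<open>e\<close> expresses \<open>y i * y j\<close>
  without ordering the endpoints.\<close>

lemma bform_noise_eq:
  "bform n (noise p E) y y = (\<Sum>e\<in>vertex_pairs n. 2 * (\<Prod>i\<in>e. y i) * ((if e \<in> E then 1 else 0) - p))"
proof -
  have "bform n (noise p E) y y =
      (\<Sum>i<n. \<Sum>j<n. if i = j then 0 else (\<lambda>e. (\<Prod>i\<in>e. y i) * ((if e \<in> E then 1 else 0) - p)) {i, j})"
    unfolding bform_alt by (intro sum.cong refl) (auto simp: noise_def adj_def)
  also have "\<dots> = 2 * (\<Sum>e\<in>vertex_pairs n. (\<Prod>i\<in>e. y i) * ((if e \<in> E then 1 else 0) - p))"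
    by (rule sum_off_diagonal)
  finally show ?thesis by (simp add: sum_distrib_left mult_ac)
qed

text \<open>The weights \<open>2 * y i * y j\<close> have squares summing to at most
  \<open>2 * R^2\<close>, as seen by expanding the square of \<open>dot n y y\<close>. This makes
  the Hoeffding exponent exactly \<open>- t^2\<close>.\<close>

lemma prob_bform_noise:
  assumes p: "0 < p" "p < 1" and y: "dot n y y \<le> R" and "0 < R" "0 < t"
  shows "measure_pmf.prob (gnp n p) {E. R * t \<le> \<bar>bform n (noise p E) y y\<bar>} \<le> 2 * exp (- t\<^sup>2)"
proof -
  have "2 * (\<Sum>e\<in>vertex_pairs n. (\<Prod>i\<in>e. (y i)\<^sup>2)) = (\<Sum>i<n. \<Sum>j<n. if i = j then 0 else (\<Prod>i\<in>{i, j}. (y i)\<^sup>2))"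
    by (rule sum_off_diagonal[symmetric])
  also have "\<dots> \<le> (\<Sum>i<n. \<Sum>j<n. (y i)\<^sup>2 * (y j)\<^sup>2)"
    by (intro sum_mono) auto
  also have "\<dots> = (dot n y y)\<^sup>2"
    by (simp add: dot_def power2_eq_square sum_product)
  also have "\<dots> \<le> R\<^sup>2" using y dot_nonneg by (intro power_mono) auto
  finally have "2 * (2 * (\<Sum>e\<in>vertex_pairs n. \<Prod>i\<in>e. (y i)\<^sup>2)) \<le> 2 * R\<^sup>2" by simp
  moreover have "(2 * (\<Prod>i\<in>e. y i))\<^sup>2 = 2 * (2 * (\<Prod>i\<in>e. (y i)\<^sup>2))" for e
    by (simp add: power_mult_distrib prod_power_distrib)
  ultimately have "(\<Sum>e\<in>vertex_pairs n. (2 * (\<Prod>i\<in>e. y i))\<^sup>2) \<le> 2 * R\<^sup>2"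
    by (simp only: sum_distrib_left)
  then have "measure_pmf.prob (gnp n p) {E. R * t \<le> \<bar>bform n (noise p E) y y\<bar>} \<le> 2 * exp (- 2 * (R * t)\<^sup>2 / (2 * R\<^sup>2))"
    unfolding bform_noise_eq by (rule Hoeffding_gnp[OF p]) (use \<open>0 < R\<close> \<open>0 < t\<close> in auto)
  also have "- 2 * (R * t)\<^sup>2 / (2 * R\<^sup>2) = - t\<^sup>2"
    using \<open>0 < R\<close> by (simp add: power_mult_distrib)
  finally show ?thesis .
qed

lemma prob_degree_deviation:
  assumes p: "0 < p" "p < 1" and "u < n" "0 < t"
  shows "measure_pmf.prob (gnp n p) {E. E \<subseteq> vertex_pairs n \<and> t \<le> \<bar>real (degree_of E u) - p * (real n - 1)\<bar>}
    \<le> 2 * exp (- 2 * t\<^sup>2 / real n)"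
proof -
  let ?w = "\<lambda>e. if u \<in> e then 1 else 0 :: real"
  have deg: "real (degree_of E u) = (\<Sum>e\<in>vertex_pairs n. ?w e * (if e \<in> E then 1 else 0))"
    if "E \<subseteq> vertex_pairs n" for E
  proof -
    have "{e \<in> E. u \<in> e} = {e \<in> vertex_pairs n. u \<in> e \<and> e \<in> E}" using that by auto
    then have "real (degree_of E u) = (\<Sum>e\<in>vertex_pairs n. if u \<in> e \<and> e \<in> E then 1 else 0)"
      by (simp add: degree_of_def finite_vertex_pairs flip: sum.inter_filter)
    also have "\<dots> = (\<Sum>e\<in>vertex_pairs n. ?w e * (if e \<in> E then 1 else 0))"
      by (intro sum.cong refl) auto
    finally show ?thesis .
  qed
  have "real (degree_of (vertex_pairs n) u) = (\<Sum>j<n. adj (vertex_pairs n) u j)"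
    using \<open>u < n\<close> by (intro degree_of_eq_sum) auto
  also have "\<dots> = (\<Sum>j<n. 1 - (if j = u then 1 else 0))"
    using \<open>u < n\<close> by (intro sum.cong refl) (auto simp: adj_def insert_in_vertex_pairs_iff)
  also have "\<dots> = real n - 1" using \<open>u < n\<close> by (simp add: sum_subtractf)
  finally have w: "(\<Sum>e\<in>vertex_pairs n. ?w e) = real n - 1"
    using deg[of "vertex_pairs n"] by simp
  have "(\<Sum>e\<in>vertex_pairs n. (?w e)\<^sup>2) \<le> real n"
    using w by (simp add: if_distrib[of "\<lambda>x. x\<^sup>2"] cong: if_cong)
  then have "measure_pmf.prob (gnp n p) {E. t \<le> \<bar>\<Sum>e\<in>vertex_pairs n. ?w e * ((if e \<in> E then 1 else 0) - p)\<bar>}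
      \<le> 2 * exp (- 2 * t\<^sup>2 / real n)"
    by (rule Hoeffding_gnp[OF p]) (use assms in auto)
  moreover have "measure_pmf.prob (gnp n p) {E. E \<subseteq> vertex_pairs n \<and> t \<le> \<bar>real (degree_of E u) - p * (real n - 1)\<bar>}
      \<le> measure_pmf.prob (gnp n p) {E. t \<le> \<bar>\<Sum>e\<in>vertex_pairs n. ?w e * ((if e \<in> E then 1 else 0) - p)\<bar>}"
  proof (rule measure_pmf.finite_measure_mono)
    have "(\<Sum>e\<in>vertex_pairs n. ?w e * ((if e \<in> E then 1 else 0) - p)) = real (degree_of E u) - p * (real n - 1)"
      if "E \<subseteq> vertex_pairs n" for E
      unfolding deg[OF that] w[symmetric] by (simp add: right_diff_distrib sum_subtractf sum_distrib_left mult.commute)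
    then show "{E. E \<subseteq> vertex_pairs n \<and> t \<le> \<bar>real (degree_of E u) - p * (real n - 1)\<bar>}
      \<subseteq> {E. t \<le> \<bar>\<Sum>e\<in>vertex_pairs n. ?w e * ((if e \<in> E then 1 else 0) - p)\<bar>}" by auto
  qed auto
  ultimately show ?thesis by linarith
qed

text \<open>A violation at some real vector forces one at a net point, so a finite union bound
  applies. The case \<open>k = n\<close>, \<open>x = 1\<close> serves the norm bound;
  \<open>k\<close> about \<open>c * n\<close> with small \<open>x\<close> serves the sparse
  one.\<close>

lemma prob_bform_noise_sparse:
  assumes p: "0 < p" "p < 1" and "1 \<le> k" "0 < t" and x: "0 < x" "x \<le> 1"
  shows "measure_pmf.prob (gnp n p)
      {E. \<exists>y. card {i. i < n \<and> y i \<noteq> 0} \<le> k \<and> 3 * t * dot n y y < \<bar>bform n (noise p E) y y\<bar>}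
    \<le> 2 * exp (real k * (16 + ln (1 / x)) + 2 * x * real n - t\<^sup>2)"
proof -
  let ?B = "\<lambda>m. {E. 16 * real k * t \<le> \<bar>bform n (noise p E) (\<lambda>i. real_of_int (m i)) (\<lambda>i. real_of_int (m i))\<bar>}"
  have "{E. \<exists>y. card {i. i < n \<and> y i \<noteq> 0} \<le> k \<and> 3 * t * dot n y y < \<bar>bform n (noise p E) y y\<bar>}
      \<subseteq> (\<Union>m\<in>lattice_net n k. ?B m)"
  proof (rule subsetI, rule ccontr)
    fix E assume E: "E \<in> {E. \<exists>y. card {i. i < n \<and> y i \<noteq> 0} \<le> k \<and> 3 * t * dot n y y < \<bar>bform n (noise p E) y y\<bar>}"
      and "E \<notin> (\<Union>m\<in>lattice_net n k. ?B m)"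
    then have "\<bar>bform n (noise p E) (\<lambda>i. real_of_int (m i)) (\<lambda>i. real_of_int (m i))\<bar> \<le> 16 * real k * t"
      if "m \<in> lattice_net n k" for m using that by force
    then have "\<bar>bform n (noise p E) y y\<bar> \<le> 3 * t * dot n y y" if "card {i. i < n \<and> y i \<noteq> 0} \<le> k" for y
      using bform_bound_from_net[of n "noise p E" k t y] noise_commute \<open>1 \<le> k\<close> that by blast
    with E show False by force
  qed
  then have "measure_pmf.prob (gnp n p)
      {E. \<exists>y. card {i. i < n \<and> y i \<noteq> 0} \<le> k \<and> 3 * t * dot n y y < \<bar>bform n (noise p E) y y\<bar>}
      \<le> measure_pmf.prob (gnp n p) (\<Union>m\<in>lattice_net n k. ?B m)"
    by (intro measure_pmf.finite_measure_mono) auto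
  also have "\<dots> \<le> (\<Sum>m\<in>lattice_net n k. measure_pmf.prob (gnp n p) (?B m))"
    by (intro measure_pmf.finite_measure_subadditive_finite finite_lattice_net) auto
  also have "\<dots> \<le> (\<Sum>m\<in>lattice_net n k. 2 * exp (- t\<^sup>2))"
  proof (rule sum_mono)
    fix m assume "m \<in> lattice_net n k"
    then have "real_of_int (\<Sum>i<n. (m i)\<^sup>2) \<le> real_of_int (int (16 * k))"
      unfolding of_int_le_iff by (simp add: lattice_net_def)
    then have "dot n (\<lambda>i. real_of_int (m i)) (\<lambda>i. real_of_int (m i)) \<le> 16 * real k"
      by (simp add: dot_def power2_eq_square)
    then show "measure_pmf.prob (gnp n p) (?B m) \<le> 2 * exp (- t\<^sup>2)"
      using assms by (intro prob_bform_noise) auto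
  qed
  also have "\<dots> \<le> exp (real k * (16 + ln (1 / x)) + 2 * x * real n) * (2 * exp (- t\<^sup>2))"
    using card_lattice_net[OF x, of n k] by (simp add: mult_right_mono)
  also have "\<dots> = 2 * exp (real k * (16 + ln (1 / x)) + 2 * x * real n - t\<^sup>2)"
    by (simp add: exp_diff exp_minus field_simps)
  finally show ?thesis .
qed

section \<open>Delocalization\<close>

text \<open>The deterministic side. From these properties of one fixed graph, together with the
  sparse bound, everything about the minimizer follows, however it depends on the graph.\<close>

locale noise_bounded =
  fixes n :: nat and E :: "nat set set" and p K :: real
  assumes E: "E \<subseteq> vertex_pairs n" and n: "2 \<le> n" and p: "0 < p" "p < 1" and K: "1 \<le> K"
    and degree_lower: "\<And>i. i < n \<Longrightarrow> p * real n / 2 \<le> real (degree_of E i)"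
    and noise_norm: "\<And>y. \<bar>bform n (noise p E) y y\<bar> \<le> K * sqrt (real n) * dot n y y"
begin

abbreviation "M \<equiv> noise p E"
abbreviation "deg i \<equiv> real (degree_of E i)"
abbreviation "tot x \<equiv> \<Sum>i<n. x i"

lemma root_n: "0 < sqrt (real n)" "sqrt (real n) * sqrt (real n) = real n"
  using n by auto

lemma noise_bilinear: "\<bar>bform n M u v\<bar> \<le> K * sqrt (real n) * (sqrt (dot n u u) * sqrt (dot n v v))"
  by (rule bform_polarization_bound[where T = UNIV]) (simp_all add: noise_commute noise_norm)

text \<open>Apply the bilinear bound to \<open>M v\<close> and \<open>v\<close>, then cancel one
  factor.\<close>

lemma noise_operator: "sqrt (dot n (mv n M v) (mv n M v)) \<le> K * sqrt (real n) * sqrt (dot n v v)"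
proof (cases "dot n (mv n M v) (mv n M v) = 0")
  case True
  then show ?thesis using K dot_nonneg[of n v] by simp
next
  case False
  then have pos: "0 < sqrt (dot n (mv n M v) (mv n M v))" using dot_nonneg[of n "mv n M v"] by simp
  have "sqrt (dot n (mv n M v) (mv n M v)) * sqrt (dot n (mv n M v) (mv n M v)) = bform n M (mv n M v) v"
    using dot_nonneg[of n "mv n M v"] by (simp add: bform_def)
  also have "\<dots> \<le> K * sqrt (real n) * (sqrt (dot n (mv n M v) (mv n M v)) * sqrt (dot n v v))"
    using noise_bilinear[of "mv n M v" v] by linarith
  finally have "sqrt (dot n (mv n M v) (mv n M v)) * sqrt (dot n (mv n M v) (mv n M v))
      \<le> (K * sqrt (real n) * sqrt (dot n v v)) * sqrt (dot n (mv n M v) (mv n M v))"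
    by (simp only: mult_ac)
  then show ?thesis using pos by (rule mult_right_le_imp_le)
qed

lemma adj_eq: "adj E i j = p - (if i = j then p else 0) + M i j"
  by (simp add: noise_def adj_def)

lemma bform_adj: "bform n (adj E) x y = p * (tot x * tot y) - p * dot n x y + bform n M x y"
proof -
  have "bform n (adj E) x y = (\<Sum>i<n. \<Sum>j<n. p * (x i * y j)) - (\<Sum>i<n. \<Sum>j<n. if i = j then p * (x i * y i) else 0)
      + bform n M x y"
    unfolding bform_alt sum.distrib[symmetric] sum_subtractf[symmetric]
    by (intro sum.cong refl) (auto simp: adj_eq algebra_simps)
  then show ?thesis
    by (simp add: sum_product dot_def flip: sum_distrib_left)
qed

lemma degree_eq: "i < n \<Longrightarrow> deg i = p * (real n - 1) + mv n M (\<lambda>_. 1) i"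
  unfolding degree_of_eq_sum[OF E] adj_eq mv_def by (simp add: sum.distrib sum_subtractf algebra_simps)

lemma degree_upper: "i < n \<Longrightarrow> deg i \<le> real n"
  using sum_mono[of "{..<n}" "\<lambda>j. adj E i j" "\<lambda>_. 1"] by (simp add: degree_of_eq_sum[OF E] adj_def)

lemma degree_pos: "i < n \<Longrightarrow> 0 < degree_of E i"
  using degree_lower[of i] p n by (smt (verit) divide_pos_pos mult_pos_pos of_nat_0_less_iff pos2 order_less_le_trans zero_less_numeral)

lemma total_degree: "p * (real n)\<^sup>2 / 2 \<le> tot deg"
  using sum_mono[of "{..<n}" "\<lambda>_. p * real n / 2" deg] degree_lower by (simp add: power2_eq_square algebra_simps)

lemma dot_one: "dot n (\<lambda>_. 1) (\<lambda>_. 1) = real n"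
  by (simp add: dot_def)

lemma weighted_total: "(\<Sum>i<n. deg i * x i) = p * (real n - 1) * tot x + bform n M x (\<lambda>_. 1)"
proof -
  have "(\<Sum>i<n. deg i * x i) = (\<Sum>i<n. p * (real n - 1) * x i + x i * mv n M (\<lambda>_. 1) i)"
    by (intro sum.cong refl) (simp add: degree_eq algebra_simps)
  then show ?thesis by (simp add: sum.distrib bform_def dot_def flip: sum_distrib_left)
qed

text \<open>The degrees are nearly constant, so orthogonality to them makes \<open>x\<close> nearly
  orthogonal to the constant vector. The total is bounded independently of \<open>n\<close>, where
  Cauchy-Schwarz alone would allow \<open>sqrt n\<close>; hence the rank-one mean contributes only a
  constant to the form.\<close>

lemma total_le:
  assumes "(\<Sum>i<n. deg i * x i) = 0" "dot n x x = 1"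
  shows "\<bar>tot x\<bar> \<le> 2 * K / p"
proof -
  have "p * (real n - 1) * tot x = - bform n M x (\<lambda>_. 1)"
    using assms(1) weighted_total[of x] by simp
  then have "p * (real n - 1) * \<bar>tot x\<bar> = \<bar>bform n M x (\<lambda>_. 1)\<bar>"
    using p n by (metis abs_minus_cancel abs_mult abs_of_nonneg diff_ge_0_iff_ge less_imp_le
        mult_nonneg_nonneg of_nat_1 of_nat_mono one_le_numeral order_trans)
  also have "\<dots> \<le> K * sqrt (real n) * (1 * sqrt (real n))"
    using noise_bilinear[of x "\<lambda>_. 1"] assms(2) by (simp add: dot_one)
  also have "\<dots> = K * real n" using root_n by (simp add: algebra_simps)
  finally have *: "p * (real n - 1) * \<bar>tot x\<bar> \<le> K * real n" .
  have "p * (real n / 2) * \<bar>tot x\<bar> \<le> p * (real n - 1) * \<bar>tot x\<bar>"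
    using n p by (intro mult_right_mono mult_left_mono) auto
  then have "real n * (p * \<bar>tot x\<bar>) \<le> real n * (2 * K)" using * by (simp add: algebra_simps)
  then show ?thesis using n p by (simp add: field_simps)
qed

text \<open>Moves the size of \<open>mu\<close> over to the noise. The rank-one part costs at most
  \<open>p * (2 * K / p)^2 = 4 * K^2 / p\<close>, and the degree bound replaces the weighted norm by
  the Euclidean one.\<close>

lemma noise_form_ge:
  assumes x: "(\<Sum>i<n. deg i * x i) = 0" "dot n x x = 1"
    and mu: "mu * (\<Sum>i<n. deg i * (x i)\<^sup>2) \<le> bform n (adj E) x x" "0 \<le> mu"
  shows "mu * (p * real n / 2) \<le> bform n M x x + 4 * K\<^sup>2 / p"
proof -
  have "p * real n / 2 * dot n x x \<le> (\<Sum>i<n. deg i * (x i)\<^sup>2)"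
    unfolding dot_def sum_distrib_left using degree_lower
    by (intro sum_mono) (simp only: power2_eq_square lessThan_iff, intro mult_right_mono, auto)
  then have "mu * (p * real n / 2) \<le> mu * (\<Sum>i<n. deg i * (x i)\<^sup>2)"
    using mu(2) x(2) by (intro mult_left_mono) auto
  also have "\<dots> \<le> p * (tot x * tot x) - p + bform n M x x"
    using mu(1) x(2) by (simp add: bform_adj)
  also have "\<dots> \<le> p * (tot x * tot x) + bform n M x x" using p by simp
  also have "tot x * tot x = \<bar>tot x\<bar> * \<bar>tot x\<bar>" by simp
  also have "p * (\<bar>tot x\<bar> * \<bar>tot x\<bar>) \<le> p * ((2 * K / p) * (2 * K / p))"
    using total_le[OF x] p by (intro mult_left_mono mult_mono) auto
  also have "\<dots> = 4 * K\<^sup>2 / p" using p by (simp add: power2_eq_square)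
  finally show ?thesis by simp
qed

text \<open>The test vector \<open>e\<^sub>u + s M e\<^sub>u\<close> for a vertex \<open>u\<close> whose degree deviates little from its mean.\<close>
lemma gap_le:
  assumes gap: "\<And>z. (\<Sum>i<n. deg i * z i) = 0 \<Longrightarrow> lam * (\<Sum>i<n. deg i * (z i)\<^sup>2) \<le> energy n E z"
    and large: "(min p (1 - p))\<^sup>2 * sqrt (real n) / (2 * K) + 2 + 18 / p
      \<le> (min p (1 - p))\<^sup>2 * (real n - 1) / (K * sqrt (real n))"
  shows "(min p (1 - p))\<^sup>2 / (4 * K) / sqrt (real n) \<le> 1 - lam"
proof -
  define q where "q = min p (1 - p)"
  have q: "0 < q" using p by (simp add: q_def)
  define one :: "nat \<Rightarrow> real" where "one = (\<lambda>_. 1)"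
  \<comment> \<open>Averaging: the squared norm of \<open>M 1\<close> is at most
    \<open>K^2 * n^2\<close>, so not all coordinates can exceed \<open>K * sqrt n\<close>.\<close>
  have "\<exists>u<n. \<bar>mv n M one u\<bar> \<le> K * sqrt (real n)"
  proof (rule ccontr)
    assume none: "\<not> ?thesis"
    then have big: "K * sqrt (real n) < \<bar>mv n M one u\<bar>" if "u < n" for u
      using that none by (meson not_le)
    have "(\<Sum>u<n. (K * sqrt (real n))\<^sup>2) < (\<Sum>u<n. (mv n M one u)\<^sup>2)"
    proof (rule sum_strict_mono)
      fix u assume "u \<in> {..<n}"
      then have "(K * sqrt (real n))\<^sup>2 < \<bar>mv n M one u\<bar>\<^sup>2"
        using big K by (intro power_strict_mono) auto
      then show "(K * sqrt (real n))\<^sup>2 < (mv n M one u)\<^sup>2" by simp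
    qed (use n in \<open>auto simp: lessThan_empty_iff\<close>)
    moreover have "(sqrt (dot n (mv n M one) (mv n M one)))\<^sup>2 \<le> (K * sqrt (real n) * sqrt (dot n one one))\<^sup>2"
      using noise_operator[of one] dot_nonneg by (intro power_mono) auto
    ultimately show False
      using dot_nonneg[of n "mv n M one"] dot_one
      by (simp add: one_def dot_def power_mult_distrib power2_eq_square[of "mv n M _ _"]
        power2_eq_square[of "real n"] mult_ac)
  qed
  then obtain u where u: "u < n" "\<bar>mv n M one u\<bar> \<le> K * sqrt (real n)" by blast
  define m where "m = M u"
  \<comment> \<open>With this scale the quadratic term is at least
    \<open>- s^2 * K * sqrt n * N = - s * N\<close>, which uses up only half of the cross term
    \<open>2 * s * N\<close>.\<close>
  define s where "s = 1 / (K * sqrt (real n))"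
  define e where "e i = (if i = u then 1 else 0 :: real)" for i
  define z where "z i = e i + s * m i" for i
  define N where "N = dot n m m"
  have s: "0 < s" "s * (K * sqrt (real n)) = 1" using K root_n by (simp_all add: s_def)
  have dot_e: "dot n e v = v u" for v
    using u(1) by (simp add: dot_def e_def if_distrib[of "\<lambda>a. a * _"] cong: if_cong)
  have "m u = 0" by (simp add: m_def noise_def)
  have m1: "\<bar>m i\<bar> \<le> 1" and m2: "i \<noteq> u \<Longrightarrow> q \<le> \<bar>m i\<bar>" for i
    using p by (auto simp: m_def noise_def adj_def q_def)
  have "N \<le> real n"
  proof -
    have "m i * m i \<le> 1" for i
      using mult_mono[OF m1[of i] m1[of i]] by simp
    then have "(\<Sum>i<n. m i * m i) \<le> (\<Sum>i<n. 1)" by (intro sum_mono)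
    then show ?thesis by (simp add: N_def dot_def)
  qed
  have "q\<^sup>2 * (real n - 1) \<le> N"
  proof -
    have "q * q \<le> m i * m i" if "i \<noteq> u" for i
      using mult_mono[OF m2[OF that] m2[OF that]] q by simp
    then have "(\<Sum>i\<in>{..<n} - {u}. q * q) \<le> (\<Sum>i\<in>{..<n} - {u}. m i * m i)"
      by (intro sum_mono) auto
    also have "\<dots> \<le> N" unfolding N_def dot_def by (intro sum_mono2) auto
    finally show ?thesis using u(1) n by (simp add: power2_eq_square of_nat_diff algebra_simps)
  qed
  have "N \<ge> 0" by (simp add: N_def dot_nonneg)
  have sqrtN: "sqrt N \<le> sqrt (real n)" using \<open>N \<le> real n\<close> by simp
  have "bform n M z z = bform n M e e + 2 * bform n M e (\<lambda>i. s * m i) + bform n M (\<lambda>i. s * m i) (\<lambda>i. s * m i)"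
    unfolding z_def by (rule bform_add_self(1)) (rule noise_commute)
  also have "bform n M e e = 0"
    unfolding bform_def dot_e using u(1)
    by (simp add: mv_def e_def noise_def if_distrib[of "\<lambda>a. _ * a"] cong: if_cong)
  also have "bform n M e (\<lambda>i. s * m i) = s * N"
    unfolding bform_scale unfolding bform_def dot_e by (simp add: mv_def N_def dot_def m_def)
  finally have Mz_eq: "bform n M z z = 2 * (s * N) + bform n M (\<lambda>i. s * m i) (\<lambda>i. s * m i)" by simp
  have "bform n M (\<lambda>i. s * m i) (\<lambda>i. s * m i) \<ge> - (s * N)"
  proof -
    have "- (K * sqrt (real n) * N) \<le> bform n M m m" using noise_norm[of m] by (simp add: N_def abs_le_iff)
    then have "(s * s) * - (K * sqrt (real n) * N) \<le> (s * s) * bform n M m m"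
      using s by (intro mult_left_mono) auto
    moreover have "(s * s) * - (K * sqrt (real n) * N) = - (s * N) * (s * (K * sqrt (real n)))" by simp
    then have "(s * s) * - (K * sqrt (real n) * N) = - (s * N)" unfolding s(2) by simp
    ultimately show ?thesis by (simp only: bform_scale mult.assoc)
  qed
  then have Mz: "s * N \<le> bform n M z z" unfolding Mz_eq by linarith
  have "s * s * N \<le> 1"
  proof -
    have "s * s * N \<le> s * s * real n" using \<open>N \<le> real n\<close> s by (intro mult_left_mono) auto
    also have "s * s * real n = s\<^sup>2 * real n" by (simp add: power2_eq_square)
    also have "\<dots> = 1 / (K * K)"
      using n by (simp add: s_def power_divide power_mult_distrib power2_eq_square[of K])
    also have "\<dots> \<le> 1" using K mult_mono[of 1 K 1 K] by simp
    finally show ?thesis .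
  qed
  moreover have "dot n z z = 1 + s * s * N"
    using dot_e \<open>m u = 0\<close> dot_commute[of n m e] unfolding z_def dot_linear
    by (simp add: N_def) (simp add: e_def)
  ultimately have zz: "dot n z z \<le> 2" by simp
  have "(\<Sum>i<n. deg i * z i) = deg u + s * (\<Sum>i<n. deg i * m i)"
    using dot_e[of deg] by (simp add: z_def distrib_left sum.distrib sum_distrib_left dot_def mult_ac)
  also have "(\<Sum>i<n. deg i * m i) = p * (real n - 1) * mv n M one u + bform n M m one"
    unfolding weighted_total by (simp add: mv_def m_def one_def)
  finally have dz: "(\<Sum>i<n. deg i * z i) = deg u + s * (p * (real n - 1) * mv n M one u + bform n M m one)" .
  \<comment> \<open>Recentering must be cheap. The weighted sum is at most \<open>n\<close> from
    \<open>e\<close> plus \<open>2 * n\<close> from \<open>m\<close>, while the total degree is of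
    order n^2, so the correction \<open>a^2 * D\<close> stays bounded.\<close>
  have "\<bar>(\<Sum>i<n. deg i * z i)\<bar> \<le> 3 * real n"
  proof -
    have "\<bar>p * (real n - 1)\<bar> \<le> 1 * real n"
      using p n unfolding abs_mult by (intro mult_mono) auto
    then have first: "\<bar>p * (real n - 1) * mv n M one u\<bar> \<le> real n * (K * sqrt (real n))"
      using u(2) unfolding abs_mult[of "p * (real n - 1)"] by (intro mult_mono) auto
    have "\<bar>bform n M m one\<bar> \<le> K * sqrt (real n) * (sqrt N * sqrt (real n))"
      using noise_bilinear[of m one] unfolding N_def one_def dot_one .
    moreover have "\<dots> \<le> K * sqrt (real n) * (sqrt (real n) * sqrt (real n))"
      using sqrtN K by (intro mult_left_mono mult_right_mono) auto
    ultimately have "\<bar>bform n M m one\<bar> \<le> K * sqrt (real n) * (sqrt (real n) * sqrt (real n))"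
      by linarith
    then have "\<bar>bform n M m one\<bar> \<le> real n * (K * sqrt (real n))" unfolding root_n(2) by (simp only: mult_ac)
    with first have "\<bar>p * (real n - 1) * mv n M one u + bform n M m one\<bar> \<le> 2 * (real n * (K * sqrt (real n)))"
      by linarith
    then have "s * \<bar>p * (real n - 1) * mv n M one u + bform n M m one\<bar> \<le> s * (2 * (real n * (K * sqrt (real n))))"
      using s by (intro mult_left_mono) auto
    also have "\<dots> = 2 * real n * (s * (K * sqrt (real n)))" by simp
    finally have "\<bar>s * (p * (real n - 1) * mv n M one u + bform n M m one)\<bar> \<le> 2 * real n"
      unfolding s(2) using s(1) by (simp add: abs_mult)
    moreover have "0 \<le> deg u" "deg u \<le> real n" using degree_upper[OF u(1)] by auto
    ultimately show ?thesis unfolding dz by linarith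
  qed
  then have dz2: "(\<Sum>i<n. deg i * z i)\<^sup>2 \<le> 9 * (real n)\<^sup>2"
    using power_mono[of "\<bar>\<Sum>i<n. deg i * z i\<bar>" "3 * real n" 2] by (simp add: power_mult_distrib)
  define D where "D = tot deg"
  have "0 < p * (real n)\<^sup>2 / 2" using p n by simp
  then have D: "0 < D" "p * (real n)\<^sup>2 / 2 \<le> D" using total_degree by (auto simp: D_def)
  define a where "a = (\<Sum>i<n. deg i * z i) / D"
  define V where "V = (\<Sum>i<n. deg i * (z i - a)\<^sup>2)"
  have "0 \<le> V" unfolding V_def by (intro sum_nonneg) auto
  have aD: "a * D = (\<Sum>i<n. deg i * z i)" using D by (simp add: a_def)
  have "V = (\<Sum>i<n. deg i * (z i)\<^sup>2) - 2 * a * (\<Sum>i<n. deg i * z i) + a\<^sup>2 * D"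
    unfolding V_def D_def sum_distrib_left sum_subtractf[symmetric] sum.distrib[symmetric]
    by (intro sum.cong refl) (simp add: power2_eq_square algebra_simps)
  also have "\<dots> = (\<Sum>i<n. deg i * (z i)\<^sup>2) - a\<^sup>2 * D"
    unfolding aD[symmetric] by (simp add: power2_eq_square)
  finally have V: "V = (\<Sum>i<n. deg i * (z i)\<^sup>2) - a\<^sup>2 * D" .
  have "(\<Sum>i<n. deg i * (z i - a)) = 0"
    unfolding right_diff_distrib sum_subtractf sum_distrib_right[symmetric] D_def[symmetric] aD[symmetric] by simp
  from gap[OF this] have "lam * V \<le> energy n E z"
    unfolding V_def[symmetric] energy_shift[OF E] .
  then have main: "bform n (adj E) z z \<le> (1 - lam) * V + a\<^sup>2 * D"
    unfolding energy_def V by (simp add: algebra_simps)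
  have "a\<^sup>2 * D = (\<Sum>i<n. deg i * z i)\<^sup>2 / D"
    using D by (simp add: a_def power2_eq_square)
  also have "\<dots> \<le> 9 * (real n)\<^sup>2 / (p * (real n)\<^sup>2 / 2)"
    using dz2 D \<open>0 < p * (real n)\<^sup>2 / 2\<close> by (intro frac_le) auto
  also have "\<dots> = 18 / p" using n p by simp
  finally have aD2: "a\<^sup>2 * D \<le> 18 / p" .
  have "bform n (adj E) z z = p * (tot z * tot z) - p * dot n z z + bform n M z z"
    by (rule bform_adj)
  moreover have "0 \<le> p * (tot z * tot z)" using p by simp
  moreover have "p * dot n z z \<le> 1 * 2" using p zz dot_nonneg by (intro mult_mono) auto
  ultimately have "s * N - 2 \<le> bform n (adj E) z z" using Mz by linarith
  moreover have "s * N \<ge> q\<^sup>2 * (real n - 1) / (K * sqrt (real n))"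
    using mult_left_mono[OF \<open>q\<^sup>2 * (real n - 1) \<le> N\<close>, of s] s(1) by (simp add: s_def)
  ultimately have low: "q\<^sup>2 * sqrt (real n) / (2 * K) \<le> (1 - lam) * V"
    using main aD2 large[folded q_def] by linarith
  have "0 < q\<^sup>2 * sqrt (real n) / (2 * K)" using q root_n K by simp
  then have "0 < (1 - lam) * V" using low by linarith
  \<comment> \<open>The sign of \<open>1 - lam\<close> is not assumed: it follows from the positive
    product with the nonnegative \<open>V\<close>.\<close>
  then have lam: "0 < 1 - lam" using \<open>0 \<le> V\<close> by (simp add: zero_less_mult_iff)
  have "V \<le> (\<Sum>i<n. deg i * (z i)\<^sup>2)" unfolding V using D by simp
  also have "\<dots> \<le> real n * dot n z z"
    unfolding dot_def sum_distrib_left using degree_upper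
    by (intro sum_mono) (simp add: power2_eq_square mult_right_mono)
  also have "\<dots> \<le> real n * 2" using zz by (intro mult_left_mono) auto
  finally have "(1 - lam) * V \<le> (1 - lam) * (real n * 2)" using lam by (intro mult_left_mono) auto
  then have "q\<^sup>2 * sqrt (real n) / (2 * K) \<le> (1 - lam) * (real n * 2)" using low by linarith
  then have "sqrt (real n) * (q\<^sup>2 / (4 * K)) \<le> sqrt (real n) * ((1 - lam) * sqrt (real n))"
    using root_n(2) K by (simp add: field_simps)
  then have "q\<^sup>2 / (4 * K) \<le> (1 - lam) * sqrt (real n)"
    using root_n(1) by (rule mult_left_le_imp_le)
  then show ?thesis unfolding q_def[symmetric] by (subst pos_divide_le_eq[OF root_n(1)])
qed

text \<open>Split \<open>x\<close> at height \<open>d / sqrt n\<close>. If at most \<open>k\<close>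
  coordinates were large, they would contribute at most \<open>eps * sqrt n\<close>. The remainder
  has norm at most \<open>d\<close> and adds at most \<open>(2 * K * d + K * d^2) * sqrt n\<close>,
  which \<open>d \<le> 1\<close> merges into the term with \<open>3 * K * d\<close>.\<close>

lemma delocalized:
  assumes sparse: "\<And>y. card {i. i < n \<and> y i \<noteq> 0} \<le> k \<Longrightarrow> \<bar>bform n M y y\<bar> \<le> eps * sqrt (real n) * dot n y y"
    and x: "dot n x x = 1" and d: "0 < d" "d \<le> 1" and "0 \<le> eps"
    and big: "(eps + 3 * K * d) * sqrt (real n) < bform n M x x"
  shows "k < card {i. i < n \<and> d / sqrt (real n) \<le> \<bar>x i\<bar>}"
proof (rule ccontr)
  assume small: "\<not> k < card {i. i < n \<and> d / sqrt (real n) \<le> \<bar>x i\<bar>}"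
  define T where "T = {i. i < n \<and> d / sqrt (real n) \<le> \<bar>x i\<bar>}"
  then have "card T \<le> k" using small by simp
  define y where "y i = (if i \<in> T then x i else 0)" for i
  define r where "r i = (if i \<in> T then 0 else x i)" for i
  have yr: "x = (\<lambda>i. y i + r i)" by (auto simp: y_def r_def)
  have yy: "dot n y y \<le> 1"
    unfolding x[symmetric] dot_def by (intro sum_mono) (auto simp: y_def)
  have "dot n r r \<le> (\<Sum>i<n. (d / sqrt (real n)) * (d / sqrt (real n)))"
    unfolding dot_def
  proof (intro sum_mono)
    fix i assume "i \<in> {..<n}"
    then have "\<bar>r i\<bar> \<le> d / sqrt (real n)" using d by (auto simp: r_def T_def)
    then have "\<bar>r i\<bar> * \<bar>r i\<bar> \<le> (d / sqrt (real n)) * (d / sqrt (real n))"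
      using d by (intro mult_mono) auto
    then show "r i * r i \<le> (d / sqrt (real n)) * (d / sqrt (real n))" by (simp only: abs_mult_self_eq)
  qed
  also have "\<dots> = d\<^sup>2" using n by (simp add: power2_eq_square)
  finally have rr: "dot n r r \<le> d\<^sup>2" .
  then have sr: "sqrt (dot n r r) \<le> d" using d by (intro real_le_lsqrt) auto
  have "card {i. i < n \<and> y i \<noteq> 0} \<le> card T"
    by (rule card_mono) (auto simp: T_def y_def)
  then have "\<bar>bform n M y y\<bar> \<le> eps * sqrt (real n) * dot n y y" using \<open>card T \<le> k\<close> by (intro sparse) simp
  also have "\<dots> \<le> eps * sqrt (real n) * 1" using yy \<open>0 \<le> eps\<close> by (intro mult_left_mono) auto
  finally have 1: "bform n M y y \<le> eps * sqrt (real n)" by simp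
  have "\<bar>bform n M y r\<bar> \<le> K * sqrt (real n) * (sqrt (dot n y y) * sqrt (dot n r r))" by (rule noise_bilinear)
  also have "\<dots> \<le> K * sqrt (real n) * (1 * d)"
    using sr yy K dot_nonneg[of n r] by (intro mult_left_mono mult_mono) auto
  finally have 2: "bform n M y r \<le> K * d * sqrt (real n)" by (simp add: algebra_simps)
  have "d * d \<le> d * 1" using d by (intro mult_left_mono) auto
  then have rd: "dot n r r \<le> d" using rr by (simp add: power2_eq_square)
  have "bform n M r r \<le> K * sqrt (real n) * dot n r r" using noise_norm[of r] by simp
  also have "\<dots> \<le> K * sqrt (real n) * d" using rd K by (intro mult_left_mono) auto
  finally have 3: "bform n M r r \<le> K * d * sqrt (real n)" by (simp add: algebra_simps)
  have "bform n M x x = bform n M y y + 2 * bform n M y r + bform n M r r"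
    unfolding yr by (rule bform_add_self(1)) (rule noise_commute)
  also have "\<dots> \<le> (eps + 3 * K * d) * sqrt (real n)" using 1 2 3 by (simp add: algebra_simps)
  finally show False using big by simp
qed

text \<open>Expander mixing for the indicator of \<open>S\<close>: the mean part of the adjacency
  form is \<open>p * s * (s - 1)\<close> with \<open>s = card S\<close>, and the noise part is at
  most \<open>K * sqrt n * s\<close>.\<close>

lemma card_nonedges_within:
  assumes S: "S \<subseteq> {..<n}"
  shows "(1 - p) * (real (card S) * (real (card S) - 1)) - K * sqrt (real n) * real (card S)
    \<le> 2 * real (card {e \<in> vertex_pairs n. e \<notin> E \<and> e \<subseteq> S})"
proof -
  define y where "y i = (if i \<in> S then 1 else 0 :: real)" for i
  have sum_y: "(\<Sum>i<n. y i * f i) = (\<Sum>i\<in>S. f i)" for f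
    unfolding y_def using S by (intro sum.mono_neutral_cong_right) auto
  have toty: "tot y = real (card S)" using sum_y[of "\<lambda>_. 1"] by simp
  have yy: "dot n y y = real (card S)" unfolding dot_def sum_y by (simp add: y_def)
  have "2 * real (card {e \<in> vertex_pairs n. e \<notin> E \<and> e \<subseteq> S}) =
      2 * (\<Sum>e\<in>vertex_pairs n. if e \<notin> E \<and> e \<subseteq> S then 1 else 0)"
    by (simp add: finite_vertex_pairs flip: sum.inter_filter)
  also have "\<dots> = (\<Sum>i<n. \<Sum>j<n. if i = j then 0 else if {i, j} \<notin> E \<and> {i, j} \<subseteq> S then 1 else 0)"
    by (rule sum_off_diagonal[symmetric])
  also have "\<dots> = (\<Sum>i<n. \<Sum>j<n. y i * y j) - (\<Sum>i<n. \<Sum>j<n. if i = j then y i * y i else 0) - bform n (adj E) y y"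
    unfolding bform_alt sum_subtractf[symmetric]
    by (intro sum.cong refl) (auto simp: y_def adj_def)
  also have "\<dots> = tot y * tot y - dot n y y - bform n (adj E) y y"
    by (simp add: sum_product dot_def)
  also have "\<dots> = (1 - p) * (real (card S) * (real (card S) - 1)) - bform n M y y"
    unfolding bform_adj toty yy by (simp add: algebra_simps)
  finally show ?thesis using noise_norm[of y] unfolding yy by linarith
qed

end

text \<open>By Markov at most \<open>c * n / 2\<close> coordinates have square above
  \<open>2 / (c * n)\<close>, so at least \<open>c * n / 2\<close> of the large ones survive. The
  majority sign retains half of these, and equal signs make all products positive.\<close>

lemma exists_spread_set:
  assumes x: "dot n x x = 1" and "0 < c" "0 < a" "1 \<le> n"
    and many: "c * real n \<le> real (card {i. i < n \<and> a \<le> \<bar>x i\<bar>})"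
  obtains S where "S \<subseteq> {..<n}" "c * real n / 4 \<le> real (card S)"
    "\<And>i. i \<in> S \<Longrightarrow> x i \<noteq> 0" "\<And>i. i \<in> S \<Longrightarrow> (x i)\<^sup>2 \<le> 2 / (c * real n)"
    "\<And>i j. i \<in> S \<Longrightarrow> j \<in> S \<Longrightarrow> a\<^sup>2 \<le> x i * x j"
proof -
  define T where "T = {i. i < n \<and> a \<le> \<bar>x i\<bar>}"
  define H where "H = {i. i < n \<and> 2 / (c * real n) < (x i)\<^sup>2}"
  define U where "U = {i \<in> T - H. 0 < x i}"
  define W where "W = {i \<in> T - H. x i < 0}"
  have fin: "finite T" "finite H" "finite U" "finite W" by (auto simp: T_def H_def U_def W_def)
  have cn: "0 < c * real n" using assms by simp
  have "real (card H) * (2 / (c * real n)) \<le> (\<Sum>i\<in>H. x i * x i)"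
    using sum_bounded_below[of H "2 / (c * real n)" "\<lambda>i. x i * x i"]
    by (auto simp: H_def power2_eq_square)
  also have "\<dots> \<le> dot n x x" unfolding dot_def by (intro sum_mono2) (auto simp: H_def)
  finally have "real (card H) \<le> c * real n / 2" using x cn by (simp add: field_simps)
  moreover have "real (card T) \<le> real (card (T - H)) + real (card H)"
    using diff_card_le_card_Diff[OF fin(2), of T] by linarith
  moreover have "T - H = U \<union> W" using \<open>0 < a\<close> by (auto simp: U_def W_def T_def)
  then have "real (card (T - H)) \<le> real (card U) + real (card W)"
    using card_Un_le[of U W] by (metis of_nat_add of_nat_le_iff)
  moreover have "c * real n \<le> real (card T)" using many by (simp add: T_def)
  ultimately have "c * real n / 4 \<le> real (card U) \<or> c * real n / 4 \<le> real (card W)" by linarith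
  then obtain S where S: "S = U \<or> S = W" "c * real n / 4 \<le> real (card S)" by blast
  show ?thesis
  proof
    show "S \<subseteq> {..<n}" "c * real n / 4 \<le> real (card S)" using S by (auto simp: U_def W_def T_def)
    show "x i \<noteq> 0" if "i \<in> S" for i using S that by (auto simp: U_def W_def)
    show "(x i)\<^sup>2 \<le> 2 / (c * real n)" if "i \<in> S" for i
      using S that by (auto simp: U_def W_def T_def H_def)
    show "a\<^sup>2 \<le> x i * x j" if "i \<in> S" "j \<in> S" for i j
    proof -
      have "x i * x j = \<bar>x i\<bar> * \<bar>x j\<bar>" using S(1) that by (auto simp: U_def W_def)
      moreover have "a * a \<le> \<bar>x i\<bar> * \<bar>x j\<bar>"
        using S(1) that \<open>0 < a\<close> by (intro mult_mono) (auto simp: U_def W_def T_def)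
      ultimately show ?thesis by (simp add: power2_eq_square)
    qed
  qed
qed

section \<open>Many insertions that do not raise the gap\<close>

context noise_bounded
begin

text \<open>\<open>kappa\<close> is such that \<open>gap_le\<close> yields
  \<open>mu * (p * n / 2) \<ge> 2 * kappa * sqrt n\<close>; \<open>large2\<close> spends half of
  this on the rank-one correction. The rest exceeds the sum of \<open>kappa / 2\<close> from sparse
  vectors and \<open>3 * K * d = 3 / 8 * kappa\<close>, so \<open>delocalized\<close>
  applies.\<close>

lemma many_good_nonedges:
  fixes c :: real
  defines "kappa \<equiv> (min p (1 - p))\<^sup>2 * p / (16 * K)"
  assumes sparse: "\<And>y. card {i. i < n \<and> y i \<noteq> 0} \<le> k \<Longrightarrow> \<bar>bform n M y y\<bar> \<le> kappa / 2 * sqrt (real n) * dot n y y"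
    and c: "0 < c" "c * real n \<le> real k + 1"
    and large1: "(min p (1 - p))\<^sup>2 * sqrt (real n) / (2 * K) + 2 + 18 / p
      \<le> (min p (1 - p))\<^sup>2 * (real n - 1) / (K * sqrt (real n))"
    and large2: "4 * K\<^sup>2 / p \<le> kappa * sqrt (real n)"
    and large3: "(K * sqrt (real n) + 4 * K\<^sup>2 / p) * 2 / (p * real n) + 4 / (p * (real n)\<^sup>2)
      \<le> (kappa / (8 * K))\<^sup>2 * c / 2"
    and large4: "(1 - p) + K * sqrt (real n) \<le> (1 - p) * c * real n / 8"
  shows "(1 - p) * c\<^sup>2 / 64 * (real n)\<^sup>2
    \<le> real (card {e \<in> vertex_pairs n. e \<notin> E \<and> spectral_gap n (insert e E) \<le> spectral_gap n E})"
proof -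
  define q where "q = min p (1 - p)"
  define lam where "lam = spectral_gap n E"
  define mu where "mu = 1 - lam"
  define d where "d = kappa / (8 * K)"
  have q: "0 < q" "q \<le> 1" using p by (auto simp: q_def)
  have kappa: "0 < kappa" using q p K by (simp add: kappa_def q_def[symmetric])
  have d: "0 < d" using kappa K by (simp add: d_def)
  have "d \<le> 1"
  proof -
    have "q\<^sup>2 * p \<le> 1 * 1" using q p by (intro mult_mono power_le_one) auto
    then have "kappa \<le> 1" using K by (simp add: kappa_def q_def[symmetric] divide_le_eq)
    then show ?thesis using K by (simp add: d_def divide_le_eq)
  qed
  obtain x0 where x0: "(\<Sum>i<n. deg i * x0 i) = 0" "(\<Sum>i<n. deg i * (x0 i)\<^sup>2) = 1" "energy n E x0 = lam"
    and var: "\<And>z. (\<Sum>i<n. deg i * z i) = 0 \<Longrightarrow> lam * (\<Sum>i<n. deg i * (z i)\<^sup>2) \<le> energy n E z"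
    unfolding lam_def using spectral_gap_variational[OF E n degree_pos] by blast
  have mu: "q\<^sup>2 / (4 * K) / sqrt (real n) \<le> mu"
    unfolding mu_def q_def using var large1 by (rule gap_le)
  have "0 < q\<^sup>2 / (4 * K) / sqrt (real n)" using q K root_n by simp
  then have mu_pos: "0 < mu" using mu by linarith
  have "dot n x0 x0 \<noteq> 0"
  proof
    assume "dot n x0 x0 = 0"
    then have "(\<Sum>i<n. deg i * (x0 i)\<^sup>2) = 0" by (simp add: dot_eq_0_iff)
    then show False using x0(2) by simp
  qed
  then have x0_pos: "0 < dot n x0 x0" using dot_nonneg[of n x0] by simp
  \<comment> \<open>The minimizer is normalized with respect to the degrees, whereas the noise
    bounds refer to the Euclidean norm.\<close>
  define r where "r = inverse (sqrt (dot n x0 x0))"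
  define x where "x i = r * x0 i" for i
  have r: "r * r * dot n x0 x0 = 1" using x0_pos by (simp add: r_def flip: inverse_mult_distrib)
  have xx: "dot n x x = 1" using r unfolding x_def dot_linear by (simp add: mult.assoc)
  have x1: "(\<Sum>i<n. deg i * x i) = 0"
    using x0(1) by (simp add: x_def mult.left_commute[of _ r] flip: sum_distrib_left)
  have dx: "(\<Sum>i<n. deg i * (x i)\<^sup>2) = r * r * (\<Sum>i<n. deg i * (x0 i)\<^sup>2)"
    unfolding sum_distrib_left by (intro sum.cong refl) (simp add: x_def power2_eq_square)
  have "bform n (adj E) x x = r * r * bform n (adj E) x0 x0" unfolding x_def bform_scale by simp
  moreover have "bform n (adj E) x0 x0 = mu" using x0 unfolding energy_def mu_def by linarith
  ultimately have ax: "bform n (adj E) x x = mu * (\<Sum>i<n. deg i * (x i)\<^sup>2)" using dx x0(2) by simp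
  have form: "mu * (p * real n / 2) \<le> bform n M x x + 4 * K\<^sup>2 / p"
    using x1 xx ax mu_pos by (intro noise_form_ge) auto
  have "2 * kappa * sqrt (real n) = q\<^sup>2 / (4 * K) / sqrt (real n) * (p * real n / 2)"
    using root_n K by (simp add: kappa_def q_def[symmetric] field_simps)
  also have "\<dots> \<le> mu * (p * real n / 2)" using mu p by (intro mult_right_mono) auto
  finally have "kappa * sqrt (real n) \<le> bform n M x x" using form large2 by simp
  moreover have "(kappa / 2 + 3 * K * d) * sqrt (real n) < kappa * sqrt (real n)"
    using kappa K root_n(1) by (intro mult_strict_right_mono) (auto simp: d_def field_simps)
  ultimately have "k < card {i. i < n \<and> d / sqrt (real n) \<le> \<bar>x i\<bar>}"
    using kappa by (intro delocalized[of k "kappa / 2", OF sparse xx d \<open>d \<le> 1\<close>]) auto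
  then have many: "c * real n \<le> real (card {i. i < n \<and> d / sqrt (real n) \<le> \<bar>x i\<bar>})" using c by linarith
  have pos: "0 < d / sqrt (real n)" "1 \<le> n" using d n by simp_all
  obtain S where S: "S \<subseteq> {..<n}" "c * real n / 4 \<le> real (card S)"
    "\<And>i. i \<in> S \<Longrightarrow> x i \<noteq> 0" "\<And>i. i \<in> S \<Longrightarrow> (x i)\<^sup>2 \<le> 2 / (c * real n)"
    "\<And>i j. i \<in> S \<Longrightarrow> j \<in> S \<Longrightarrow> (d / sqrt (real n))\<^sup>2 \<le> x i * x j"
    by (rule exists_spread_set[OF xx c(1) pos many]; rule that; assumption)
  have D: "p * (real n)\<^sup>2 / 2 \<le> tot deg" "0 < p * (real n)\<^sup>2 / 2" using total_degree p n by auto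
  have mu_le: "mu \<le> (K * sqrt (real n) + 4 * K\<^sup>2 / p) * 2 / (p * real n)"
  proof -
    have "bform n M x x \<le> K * sqrt (real n)" using noise_norm[of x] xx by simp
    then have "mu * (p * real n / 2) \<le> K * sqrt (real n) + 4 * K\<^sup>2 / p" using form by linarith
    then show ?thesis using p n by (simp add: pos_le_divide_eq)
  qed
  have "2 / tot deg \<le> 2 / (p * (real n)\<^sup>2 / 2)" using D by (intro divide_left_mono) auto
  also have "\<dots> = 4 / (p * (real n)\<^sup>2)" by simp
  \<comment> \<open>The left side is of order n^(-1/2) and the right side is constant in
    \<open>n\<close>; here the upper bound on \<open>mu\<close> enters.\<close>
  finally have small: "mu + 2 / tot deg \<le> d\<^sup>2 * c / 2" using mu_le large3 unfolding d_def by linarith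
  have good: "spectral_gap n (insert {u, v} E) \<le> spectral_gap n E"
    if uv: "u \<in> S" "v \<in> S" "u \<noteq> v" "{u, v} \<notin> E" for u v
  proof (rule spectral_gap_insert_le[OF E n degree_pos _ _ uv(3,4) x1])
    show "u < n" "v < n" using S(1) uv by auto
    show "energy n E x \<le> spectral_gap n E * (\<Sum>i<n. deg i * (x i)\<^sup>2)"
      unfolding energy_def ax lam_def[symmetric] mu_def by (simp add: algebra_simps)
    show "x u \<noteq> 0" using S(3) uv by simp
    show "spectral_gap n E \<le> 1" using mu_pos by (simp add: mu_def lam_def)
    have "0 \<le> mu + 2 / tot deg" using mu_pos D by simp
    \<comment> \<open>On \<open>S\<close> squares are at most \<open>2 / (c * n)\<close> and
      products at least \<open>d^2 / n\<close>; the factor \<open>d^2 * c / 2\<close> is exactly the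
      ratio that the criterion tolerates.\<close>
    then have "(mu + 2 / tot deg) * ((x u)\<^sup>2 + (x v)\<^sup>2) \<le> (d\<^sup>2 * c / 2) * (2 / (c * real n) + 2 / (c * real n))"
      using small S(4) uv by (intro mult_mono add_mono) auto
    also have "\<dots> = 2 * (d / sqrt (real n))\<^sup>2"
      using c n by (simp add: power_divide field_simps)
    also have "\<dots> \<le> 2 * (x u * x v)" using S(5) uv by simp
    finally show "(1 - spectral_gap n E + 2 / tot deg) * ((x u)\<^sup>2 + (x v)\<^sup>2) \<le> 2 * x u * x v"
      by (simp add: mu_def lam_def)
  qed auto
  have "{e \<in> vertex_pairs n. e \<notin> E \<and> e \<subseteq> S} \<subseteq>
      {e \<in> vertex_pairs n. e \<notin> E \<and> spectral_gap n (insert e E) \<le> spectral_gap n E}"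
  proof safe
    fix e assume e: "e \<in> vertex_pairs n" "e \<notin> E" "e \<subseteq> S"
    from e(1) obtain u v where "e = {u, v}" "u \<noteq> v" by (rule vertex_pairsE)
    then show "spectral_gap n (insert e E) \<le> spectral_gap n E" using good e by auto
  qed
  then have "card {e \<in> vertex_pairs n. e \<notin> E \<and> e \<subseteq> S} \<le>
      card {e \<in> vertex_pairs n. e \<notin> E \<and> spectral_gap n (insert e E) \<le> spectral_gap n E}"
    by (intro card_mono) (simp_all add: finite_vertex_pairs)
  moreover have "(1 - p) * c\<^sup>2 / 64 * (real n)\<^sup>2 \<le> real (card {e \<in> vertex_pairs n. e \<notin> E \<and> e \<subseteq> S})"
  proof -
    define s where "s = real (card S)"
    have s: "c * real n / 4 \<le> s" using S(2) by (simp add: s_def)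
    have "(1 - p) * (c * real n / 4) \<le> (1 - p) * s" using s p by (intro mult_left_mono) auto
    moreover have "(1 - p) * c * real n / 8 = (1 - p) * (c * real n / 4) / 2" by simp
    ultimately have "(1 - p) + K * sqrt (real n) \<le> (1 - p) * s / 2" using large4 by linarith
    \<comment> \<open>Half of \<open>(1 - p) * s\<close> pays for the correction from
      \<open>s - 1\<close> and for the noise.\<close>
    then have "(1 - p) * s / 2 \<le> (1 - p) * (s - 1) - K * sqrt (real n)"
      unfolding right_diff_distrib[of "1 - p" s 1] mult_1_right by linarith
    then have "s * ((1 - p) * s / 2) \<le> s * ((1 - p) * (s - 1) - K * sqrt (real n))"
      by (rule mult_left_mono) (simp add: s_def)
    also have "\<dots> = (1 - p) * (s * (s - 1)) - K * sqrt (real n) * s" by (simp add: algebra_simps)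
    also have "\<dots> \<le> 2 * real (card {e \<in> vertex_pairs n. e \<notin> E \<and> e \<subseteq> S})"
      unfolding s_def by (rule card_nonedges_within[OF S(1)])
    finally have 1: "(1 - p) * (s * s) / 4 \<le> real (card {e \<in> vertex_pairs n. e \<notin> E \<and> e \<subseteq> S})"
      by (simp add: mult_ac)
    have "(c * real n / 4) * (c * real n / 4) \<le> s * s" using s c by (intro mult_mono) (auto simp: s_def)
    then have "(1 - p) * ((c * real n / 4) * (c * real n / 4)) \<le> (1 - p) * (s * s)"
      using p by (intro mult_left_mono) auto
    also have "(1 - p) * ((c * real n / 4) * (c * real n / 4)) = (1 - p) * c\<^sup>2 / 64 * (real n)\<^sup>2 * 4"
      by (simp add: power2_eq_square)
    finally show ?thesis using 1 by linarith
  qed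
  ultimately show ?thesis by linarith
qed

end

text \<open>Double counting of pairs \<open>(E, e)\<close>, transferring added non-edges to removed edges.\<close>
lemma prob_r_plus_ge:
  assumes p: "0 < p" "p < 1" and n: "2 \<le> n" and "0 \<le> b" and half: "1 / 2 \<le> measure_pmf.prob (gnp n p) A"
    and A: "\<And>E. E \<in> A \<Longrightarrow> E \<subseteq> vertex_pairs n \<Longrightarrow> b * (real n)\<^sup>2 \<le>
      real (card {e \<in> vertex_pairs n. e \<notin> E \<and> spectral_gap n (insert e E) \<le> spectral_gap n E})"
  defines "g \<equiv> p / (1 - p) * b / 4"
  shows "g \<le> measure_pmf.prob (gnp n p) {E. g \<le> r_plus n E}"
proof -
  let ?V = "vertex_pairs n"
  have finV: "finite ?V" by (rule finite_vertex_pairs)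
  have count: "(\<Sum>e\<in>?V. measure_pmf.prob (gnp n p) {E. Q e E}) =
      (\<Sum>E\<in>Pow ?V. pmf (gnp n p) E * real (card {e \<in> ?V. Q e E}))" for Q
  proof -
    have "measure_pmf.prob (gnp n p) {E. Q e E} = (\<Sum>E\<in>Pow ?V. if Q e E then pmf (gnp n p) E else 0)" for e
      unfolding prob_gnp_eq_sum using finV
      by (simp add: Int_commute flip: sum.inter_filter) (intro sum.cong, auto)
    then have "(\<Sum>e\<in>?V. measure_pmf.prob (gnp n p) {E. Q e E}) =
        (\<Sum>E\<in>Pow ?V. \<Sum>e\<in>?V. if Q e E then pmf (gnp n p) E else 0)"
      by (simp add: sum.swap[of _ "Pow ?V"])
    also have "\<dots> = (\<Sum>E\<in>Pow ?V. pmf (gnp n p) E * real (card {e \<in> ?V. Q e E}))"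
      using finV by (simp add: mult.commute flip: sum.inter_filter)
    finally show ?thesis .
  qed
  define a where "a E = real (card {e \<in> ?V. e \<in> E \<and> \<not> spectral_gap n (E - {e}) < spectral_gap n E})" for E
  have "(\<Sum>E\<in>A \<inter> Pow ?V. pmf (gnp n p) E * (b * (real n)\<^sup>2)) \<le>
      (\<Sum>E\<in>A \<inter> Pow ?V. pmf (gnp n p) E *
        real (card {e \<in> ?V. e \<notin> E \<and> spectral_gap n (insert e E) \<le> spectral_gap n E}))"
    using A by (intro sum_mono mult_left_mono) auto
  also have "\<dots> \<le> (\<Sum>E\<in>Pow ?V. pmf (gnp n p) E *
      real (card {e \<in> ?V. e \<notin> E \<and> spectral_gap n (insert e E) \<le> spectral_gap n E}))"
    using finV by (intro sum_mono2) auto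
  also have "\<dots> = (\<Sum>e\<in>?V. measure_pmf.prob (gnp n p) {E. e \<notin> E \<and> spectral_gap n (insert e E) \<le> spectral_gap n E})"
    by (rule count[symmetric])
  finally have low: "1 / 2 * (b * (real n)\<^sup>2) \<le>
      (\<Sum>e\<in>?V. measure_pmf.prob (gnp n p) {E. e \<notin> E \<and> spectral_gap n (insert e E) \<le> spectral_gap n E})"
    using mult_right_mono[OF half, of "b * (real n)\<^sup>2"] \<open>0 \<le> b\<close>
    by (simp add: prob_gnp_eq_sum flip: sum_distrib_right)
  have "(\<Sum>E\<in>Pow ?V. pmf (gnp n p) E * a E) =
      (\<Sum>e\<in>?V. measure_pmf.prob (gnp n p) {E. e \<in> E \<and> \<not> spectral_gap n (E - {e}) < spectral_gap n E})"
    unfolding a_def by (rule count[symmetric])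
  also have "\<dots> = (\<Sum>e\<in>?V. p / (1 - p) *
      measure_pmf.prob (gnp n p) {E. e \<notin> E \<and> spectral_gap n (insert e E) \<le> spectral_gap n E})"
  proof (intro sum.cong refl)
    fix e assume "e \<in> ?V"
    from prob_gnp_edge_swap[OF this p, of "\<lambda>E. spectral_gap n (insert e E) \<le> spectral_gap n E"]
    show "measure_pmf.prob (gnp n p) {E. e \<in> E \<and> \<not> spectral_gap n (E - {e}) < spectral_gap n E} = p / (1 - p) *
      measure_pmf.prob (gnp n p) {E. e \<notin> E \<and> spectral_gap n (insert e E) \<le> spectral_gap n E}"
      by (simp add: insert_absorb not_less cong: conj_cong)
  qed
  finally have sum_eq: "(\<Sum>E\<in>Pow ?V. pmf (gnp n p) E * a E) = p / (1 - p) *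
      (\<Sum>e\<in>?V. measure_pmf.prob (gnp n p) {E. e \<notin> E \<and> spectral_gap n (insert e E) \<le> spectral_gap n E})"
    by (simp only: sum_distrib_left)
  \<comment> \<open>Of the factor 1/4 in \<open>g\<close>, one half comes from the probability of
    \<open>A\<close>. The other leaves \<open>2 * g\<close> in expectation, of which one
    \<open>g\<close> is given up to the threshold.\<close>
  have "2 * (r * b / 4) * m = r * (1 / 2 * (b * m))" for r m :: real by simp
  then have "2 * g * (real n)\<^sup>2 = p / (1 - p) * (1 / 2 * (b * (real n)\<^sup>2))"
    unfolding g_def .
  also have "\<dots> \<le> (\<Sum>E\<in>Pow ?V. pmf (gnp n p) E * a E)"
    unfolding sum_eq using low p by (intro mult_left_mono) auto
  finally have sum_a: "2 * g * (real n)\<^sup>2 \<le> (\<Sum>E\<in>Pow ?V. pmf (gnp n p) E * a E)" .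
  have card_V: "real (card ?V) \<le> (real n)\<^sup>2"
  proof -
    have "2 * real (card ?V) = (\<Sum>i<n. \<Sum>j<n. if i = j then 0 else 1)"
      using sum_off_diagonal[of "\<lambda>_. 1" n] by simp
    also have "\<dots> \<le> (\<Sum>i<n. \<Sum>j<n. 1 :: real)" by (intro sum_mono) auto
    finally show ?thesis by (simp add: power2_eq_square)
  qed
  have r_le_1: "r_plus n E \<le> 1" for E
    by (simp add: r_plus_def r_minus_def)
  \<comment> \<open>The denominator \<open>card E\<close> of \<open>r_plus\<close> is at most
    \<open>n^2\<close>. For empty \<open>E\<close> the value of \<open>r_plus\<close> is 1, which is
    harmless because \<open>a E = 0\<close>.\<close>
  have r_ge: "a E \<le> r_plus n E * (real n)\<^sup>2" if "E \<subseteq> ?V" for E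
  proof (cases "E = {}")
    case True
    then show ?thesis by (simp add: a_def r_plus_def r_minus_def)
  next
    case False
    have "finite E" using that finV finite_subset by blast
    have "{e \<in> ?V. e \<in> E \<and> \<not> spectral_gap n (E - {e}) < spectral_gap n E} =
        E - {e \<in> E. spectral_gap n (E - {e}) < spectral_gap n E}" using that by auto
    then have "a E = real (card E) - real (card {e \<in> E. spectral_gap n (E - {e}) < spectral_gap n E})"
      using \<open>finite E\<close> by (simp add: a_def card_Diff_subset of_nat_diff card_mono)
    then have "a E = r_plus n E * real (card E)"
      using False \<open>finite E\<close> by (simp add: r_plus_def r_minus_def left_diff_distrib)
    moreover have "0 < real (card E)" using False \<open>finite E\<close> by (simp add: card_gt_0_iff)
    moreover have "0 \<le> a E" by (simp add: a_def)
    ultimately have "0 \<le> r_plus n E" by (simp add: zero_le_mult_iff)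
    moreover note \<open>a E = r_plus n E * real (card E)\<close>
    moreover have "real (card E) \<le> (real n)\<^sup>2"
      using card_V card_mono[OF finV that] by linarith
    ultimately show ?thesis by (simp add: mult_left_mono)
  qed
  let ?R = "{E. g \<le> r_plus n E}"
  have g: "0 \<le> g" using p \<open>0 \<le> b\<close> by (simp add: g_def)
  \<comment> \<open>Reverse Markov inequality: \<open>r_plus\<close> is at most 1 on
    \<open>?R\<close> and below \<open>g\<close> off it.\<close>
  have "(\<Sum>E\<in>Pow ?V. pmf (gnp n p) E * a E) \<le>
      (\<Sum>E\<in>Pow ?V. pmf (gnp n p) E * (((if E \<in> ?R then 1 else 0) + g) * (real n)\<^sup>2))"
  proof (intro sum_mono mult_left_mono)
    fix E assume "E \<in> Pow ?V"
    then have "a E \<le> r_plus n E * (real n)\<^sup>2" using r_ge by blast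
    also have "\<dots> \<le> ((if E \<in> ?R then 1 else 0) + g) * (real n)\<^sup>2"
      using r_le_1[of E] g by (intro mult_right_mono) auto
    finally show "a E \<le> ((if E \<in> ?R then 1 else 0) + g) * (real n)\<^sup>2" .
  qed auto
  also have "\<dots> = ((\<Sum>E\<in>Pow ?V. if E \<in> ?R then pmf (gnp n p) E else 0) + g * (\<Sum>E\<in>Pow ?V. pmf (gnp n p) E)) * (real n)\<^sup>2"
    unfolding sum_distrib_left sum.distrib[symmetric] sum_distrib_right
    by (intro sum.cong refl) (auto simp: algebra_simps)
  also have "(\<Sum>E\<in>Pow ?V. pmf (gnp n p) E) = 1"
    using prob_gnp_eq_sum[of n p UNIV] measure_pmf.prob_space[of "gnp n p"] by simp
  also have "(\<Sum>E\<in>Pow ?V. if E \<in> ?R then pmf (gnp n p) E else 0) = measure_pmf.prob (gnp n p) ?R"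
    unfolding prob_gnp_eq_sum using finV by (simp add: Int_def conj_commute flip: sum.inter_filter)
  finally have "2 * g * (real n)\<^sup>2 \<le> (measure_pmf.prob (gnp n p) ?R + g) * (real n)\<^sup>2"
    using sum_a by simp
  then show ?thesis using n by simp
qed

text \<open>Three bad events. Every vector is \<open>n\<close>-sparse, so the sparse estimate with
  \<open>k = n\<close>, \<open>x = 1\<close> and \<open>t = 5 * sqrt n\<close> yields the norm bound
  with constant \<open>3 * 5 = 15\<close>; 5 is large enough because \<open>16 + 2 - 25 = -7\<close>
  is negative.\<close>

lemma prob_pseudorandom:
  assumes p: "0 < p" "p < 1" and n: "4 \<le> n" and k: "1 \<le> k" and eps: "0 < eps" and x: "0 < x" "x \<le> 1"
  shows "1 - (2 * real n * exp (- p\<^sup>2 * real n / 8) + 2 * exp (- 7 * real n)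
      + 2 * exp (real k * (16 + ln (1 / x)) + 2 * x * real n - eps\<^sup>2 * real n / 9))
    \<le> measure_pmf.prob (gnp n p) {E. noise_bounded n E p 15 \<and>
      (\<forall>y. card {i. i < n \<and> y i \<noteq> 0} \<le> k \<longrightarrow> \<bar>bform n (noise p E) y y\<bar> \<le> eps * sqrt (real n) * dot n y y)}"
    (is "1 - ?err \<le> measure_pmf.prob _ ?G")
proof -
  let ?P = "measure_pmf.prob (gnp n p)"
  define B1 where "B1 = (\<Union>u<n. {E. E \<subseteq> vertex_pairs n \<and> p * real n / 4 \<le> \<bar>real (degree_of E u) - p * (real n - 1)\<bar>})"
  define B2 where "B2 = {E. \<exists>y. card {i. i < n \<and> y i \<noteq> 0} \<le> n \<and>
      3 * (5 * sqrt (real n)) * dot n y y < \<bar>bform n (noise p E) y y\<bar>}"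
  define B3 where "B3 = {E. \<exists>y. card {i. i < n \<and> y i \<noteq> 0} \<le> k \<and>
      3 * (eps * sqrt (real n) / 3) * dot n y y < \<bar>bform n (noise p E) y y\<bar>}"
  have sn: "0 < sqrt (real n)" using n by simp
  have "?P B1 \<le> (\<Sum>u<n. ?P {E. E \<subseteq> vertex_pairs n \<and> p * real n / 4 \<le> \<bar>real (degree_of E u) - p * (real n - 1)\<bar>})"
    unfolding B1_def by (intro measure_pmf.finite_measure_subadditive_finite) auto
  also have "\<dots> \<le> (\<Sum>u<n. 2 * exp (- 2 * (p * real n / 4)\<^sup>2 / real n))"
    using p n by (intro sum_mono prob_degree_deviation) auto
  also have "- 2 * (p * real n / 4)\<^sup>2 / real n = - p\<^sup>2 * real n / 8"
    using n by (simp add: power2_eq_square field_simps)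
  finally have 1: "?P B1 \<le> 2 * real n * exp (- p\<^sup>2 * real n / 8)" by simp
  have "?P B2 \<le> 2 * exp (real n * (16 + ln (1 / 1)) + 2 * 1 * real n - (5 * sqrt (real n))\<^sup>2)"
    unfolding B2_def using p n sn by (intro prob_bform_noise_sparse) auto
  then have 2: "?P B2 \<le> 2 * exp (- 7 * real n)" by (simp add: power_mult_distrib)
  have "?P B3 \<le> 2 * exp (real k * (16 + ln (1 / x)) + 2 * x * real n - (eps * sqrt (real n) / 3)\<^sup>2)"
    unfolding B3_def using p k x eps sn by (intro prob_bform_noise_sparse) auto
  then have 3: "?P B3 \<le> 2 * exp (real k * (16 + ln (1 / x)) + 2 * x * real n - eps\<^sup>2 * real n / 9)"
    by (simp add: power_mult_distrib power_divide)
  have "UNIV - ?G \<subseteq> B1 \<union> B2 \<union> B3 \<union> - Pow (vertex_pairs n)"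
  proof (rule subsetI, rule ccontr)
    fix E assume "E \<in> UNIV - ?G" and "E \<notin> B1 \<union> B2 \<union> B3 \<union> - Pow (vertex_pairs n)"
    then have E: "E \<subseteq> vertex_pairs n" "E \<notin> B1" "E \<notin> B2" "E \<notin> B3" and nG: "E \<notin> ?G" by auto
    have "p * real n / 2 \<le> real (degree_of E i)" if "i < n" for i
    proof -
      have "\<bar>real (degree_of E i) - p * (real n - 1)\<bar> < p * real n / 4"
        using E(1,2) that by (auto simp: B1_def not_le)
      \<comment> \<open>From \<open>4 \<le> n\<close> one gets
        \<open>p * (n - 1) - p * n / 4 \<ge> p * n / 2\<close>.\<close>
      moreover have "p * 4 \<le> p * real n" using p n by (intro mult_left_mono) auto
      ultimately show ?thesis by (simp add: algebra_simps abs_if split: if_splits)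
    qed
    moreover have "\<bar>bform n (noise p E) y y\<bar> \<le> 15 * sqrt (real n) * dot n y y" for y
    proof -
      have "card {i. i < n \<and> y i \<noteq> 0} \<le> card {..<n}" by (intro card_mono) auto
      then show ?thesis using E(3) by (force simp: B2_def not_less)
    qed
    ultimately have "noise_bounded n E p 15" using E(1) p n by unfold_locales auto
    moreover have "\<bar>bform n (noise p E) y y\<bar> \<le> eps * sqrt (real n) * dot n y y"
      if "card {i. i < n \<and> y i \<noteq> 0} \<le> k" for y
      using E(4) that by (force simp: B3_def not_less)
    ultimately show False using E(1) nG by auto
  qed
  then have "?P (UNIV - ?G) \<le> ?P (B1 \<union> B2 \<union> B3 \<union> - Pow (vertex_pairs n))"
    by (intro measure_pmf.finite_measure_mono) auto
  also have "\<dots> \<le> ?P (B1 \<union> B2 \<union> B3) + ?P (- Pow (vertex_pairs n))" by (rule measure_Un_le) auto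
  also have "?P (- Pow (vertex_pairs n)) = 0" unfolding prob_gnp_eq_sum by simp
  also have "?P (B1 \<union> B2 \<union> B3) \<le> ?P (B1 \<union> B2) + ?P B3" by (rule measure_Un_le) auto
  also have "?P (B1 \<union> B2) \<le> ?P B1 + ?P B2" by (rule measure_Un_le) auto
  finally have "?P (UNIV - ?G) \<le> ?err" using 1 2 3 by simp
  then show ?thesis using measure_pmf.prob_compl[of ?G "gnp n p"] by simp
qed

theorem corollary1:
  fixes p :: real
  assumes "0 < p" and "p < 1"
  shows "\<exists>c>0. limsup (\<lambda>n. ereal (measure_pmf.prob (gnp n p) {E. r_plus n E \<ge> c})) \<ge> ereal c"
proof -
  define q where "q = min p (1 - p)"
  define kappa where "kappa = q\<^sup>2 * p / (16 * 15)"
  \<comment> \<open>\<open>x\<close> and \<open>c\<close> each spend a quarter of the Hoeffding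
    exponent \<open>(kappa / 2)^2 * n / 9\<close>: both \<open>2 * x * n\<close> and
    \<open>c * n * (16 + ln (1 / x))\<close> equal \<open>(kappa / 2)^2 * n / 36\<close>, so half of
    the exponent is left.\<close>
  define x where "x = (kappa / 2)\<^sup>2 / 72"
  define c where "c = (kappa / 2)\<^sup>2 / 36 / (16 + ln (1 / x))"
  have q: "0 < q" "q \<le> 1" using assms by (auto simp: q_def)
  then have kappa: "0 < kappa" using assms by (simp add: kappa_def)
  have "q\<^sup>2 * p \<le> 1 * 1" using q assms by (intro mult_mono power_le_one) auto
  then have "kappa / 2 \<le> 1" by (simp add: kappa_def)
  then have "(kappa / 2)\<^sup>2 \<le> 1" using kappa by (intro power_le_one) auto
  then have x: "0 < x" "x \<le> 1" using kappa by (auto simp: x_def)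
  then have "0 \<le> ln (1 / x)" by (intro ln_ge_zero) simp
  then have ln: "0 < 16 + ln (1 / x)" by linarith
  then have c: "0 < c" using kappa by (simp add: c_def)
  have c_ln: "c * (16 + ln (1 / x)) = (kappa / 2)\<^sup>2 / 36"
    by (metis c_def less_irrefl ln nonzero_eq_divide_eq)
  define b where "b = (1 - p) * c\<^sup>2 / 64"
  have b: "0 < b" using assms c by (simp add: b_def)
  define g where "g = p / (1 - p) * b / 4"
  have g: "0 < g" using assms b by (simp add: g_def)
  \<comment> \<open>The first four conditions are \<open>large1\<close> to \<open>large4\<close>
    with \<open>K = 15\<close>; the fifth makes the failure probability at most 1/2, and the sixth
    makes \<open>k\<close> positive.\<close>
  have "eventually (\<lambda>n. q\<^sup>2 * sqrt (real n) / (2 * 15) + 2 + 18 / p \<le> q\<^sup>2 * (real n - 1) / (15 * sqrt (real n))) at_top"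
    using q by real_asymp
  moreover have "eventually (\<lambda>n. 4 * 15\<^sup>2 / p \<le> kappa * sqrt (real n)) at_top"
    using kappa by real_asymp
  moreover have "eventually (\<lambda>n. (15 * sqrt (real n) + 4 * 15\<^sup>2 / p) * 2 / (p * real n) + 4 / (p * (real n)\<^sup>2)
      \<le> (kappa / (8 * 15))\<^sup>2 * c / 2) at_top"
  proof -
    have pos: "0 < (kappa / (8 * 15))\<^sup>2 * c / 2" using kappa c by simp
    have "(\<lambda>n. (15 * sqrt (real n) + 4 * 15\<^sup>2 / p) * 2 / (p * real n) + 4 / (p * (real n)\<^sup>2)) \<longlonglongrightarrow> 0"
      using assms by real_asymp
    from order_tendstoD(2)[OF this pos] show ?thesis by (rule eventually_mono) (rule less_imp_le)
  qed
  moreover have "eventually (\<lambda>n. (1 - p) + 15 * sqrt (real n) \<le> (1 - p) * c * real n / 8) at_top"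
    using assms c by real_asymp
  moreover have "eventually (\<lambda>n. 2 * real n * exp (- p\<^sup>2 * real n / 8) + 2 * exp (- 7 * real n)
      + 2 * exp (- ((kappa / 2)\<^sup>2 * real n / 18)) \<le> 1 / 2) at_top"
  proof -
    have "eventually (\<lambda>n. 2 * real n * exp (- (u * real n)) + 2 * exp (- 7 * real n) + 2 * exp (- (v * real n)) < 1 / 2) at_top"
      if "0 < u" "0 < v" for u v :: real
    proof (rule order_tendstoD(2))
      have "(\<lambda>n. 2 * real n * exp (- (u * real n))) \<longlonglongrightarrow> 0" using that by real_asymp
      moreover have "(\<lambda>n. 2 * exp (- 7 * real n)) \<longlonglongrightarrow> 0" by real_asymp
      moreover have "(\<lambda>n. 2 * exp (- (v * real n))) \<longlonglongrightarrow> 0" using that by real_asymp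
      ultimately show "(\<lambda>n. 2 * real n * exp (- (u * real n)) + 2 * exp (- 7 * real n) + 2 * exp (- (v * real n))) \<longlonglongrightarrow> 0"
        by (intro tendsto_add_zero)
    qed simp
    from this[of "p\<^sup>2 / 8" "(kappa / 2)\<^sup>2 / 18"] show ?thesis
      using assms kappa by (auto elim!: eventually_mono)
  qed
  moreover have "eventually (\<lambda>n. 1 \<le> c * real n) at_top" using c by real_asymp
  ultimately have "eventually (\<lambda>n. g \<le> measure_pmf.prob (gnp n p) {E. g \<le> r_plus n E}) at_top"
    using eventually_ge_at_top[of 4]
  proof eventually_elim
    case (elim n)
    \<comment> \<open>Rounding down bounds the size of the net through \<open>k \<le> c * n\<close>,
      while \<open>c * n \<le> k + 1\<close> turns more than \<open>k\<close> large coordinates into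
      at least \<open>c * n\<close>.\<close>
    define k where "k = nat \<lfloor>c * real n\<rfloor>"
    have k: "1 \<le> k" "real k \<le> c * real n" "c * real n \<le> real k + 1"
      using elim(6) by (auto simp: k_def le_nat_floor)
    define G where "G = {E. noise_bounded n E p 15 \<and>
      (\<forall>y. card {i. i < n \<and> y i \<noteq> 0} \<le> k \<longrightarrow> \<bar>bform n (noise p E) y y\<bar> \<le> kappa / 2 * sqrt (real n) * dot n y y)}"
    have "real k * (16 + ln (1 / x)) \<le> c * real n * (16 + ln (1 / x))"
      using k ln by (intro mult_right_mono) auto
    also have "\<dots> = c * (16 + ln (1 / x)) * real n" by (simp only: mult_ac)
    also have "\<dots> = (kappa / 2)\<^sup>2 * real n / 36" unfolding c_ln by simp
    finally have "real k * (16 + ln (1 / x)) \<le> (kappa / 2)\<^sup>2 * real n / 36" .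
    moreover have "2 * x * real n = (kappa / 2)\<^sup>2 * real n / 36" by (simp add: x_def)
    ultimately have "real k * (16 + ln (1 / x)) + 2 * x * real n - (kappa / 2)\<^sup>2 * real n / 9 \<le>
        - ((kappa / 2)\<^sup>2 * real n / 18)" by linarith
    then have "exp (real k * (16 + ln (1 / x)) + 2 * x * real n - (kappa / 2)\<^sup>2 * real n / 9)
        \<le> exp (- ((kappa / 2)\<^sup>2 * real n / 18))" by (simp only: exp_le_cancel_iff)
    then have "1 / 2 \<le> 1 - (2 * real n * exp (- p\<^sup>2 * real n / 8) + 2 * exp (- 7 * real n)
      + 2 * exp (real k * (16 + ln (1 / x)) + 2 * x * real n - (kappa / 2)\<^sup>2 * real n / 9))"
      using elim(5) by linarith
    also have "\<dots> \<le> measure_pmf.prob (gnp n p) G"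
      unfolding G_def using assms elim(7) k kappa x by (intro prob_pseudorandom) auto
    finally have half: "1 / 2 \<le> measure_pmf.prob (gnp n p) G" .
    show ?case unfolding g_def
    proof (rule prob_r_plus_ge[OF assms _ _ half])
      fix E assume "E \<in> G"
      then interpret noise_bounded n E p 15 by (simp add: G_def)
      show "b * (real n)\<^sup>2 \<le> real (card {e \<in> vertex_pairs n. e \<notin> E \<and> spectral_gap n (insert e E) \<le> spectral_gap n E})"
        unfolding b_def
        by (rule many_good_nonedges[of k]) (use \<open>E \<in> G\<close> k c elim in \<open>auto simp: G_def kappa_def q_def\<close>)
    qed (use elim b in auto)
  qed
  \<comment> \<open>The bound holds for every large \<open>n\<close>, with \<open>g\<close> both as
    threshold and as probability, and so passes to the limit superior.\<close>
  then have "ereal g \<le> limsup (\<lambda>n. ereal (measure_pmf.prob (gnp n p) {E. g \<le> r_plus n E}))"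
    by (intro le_Limsup) (auto elim: eventually_mono)
  then show ?thesis using g by blast
qed

end
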